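(* Fix integers $d$ and $n$ with $d+2\leq n\leq 2d$. There exist thresholds $0<\tau_-(n)<\tau_+(n)<\infty$ such that for each temperature $\tau<\tau_-(n)$ (respectively $\tau>\tau_+(n)$), every minimizer of $\mathcal{L}^{(\tau)}_{\mathrm{CE}}(W,W)$ subject to $W\in\operatorname{SMC}(d,n)$ is a low-entropy (respectively high-entropy) softmax code.
   Context: $[n]=\{1,\ldots,n\}$. For a configuration $X=\{x_i\}_{i\in[n]}$ in the unit sphere $S^{d-1}$, let $\delta(X):=\min_{j\in[n]}\operatorname{dist}(x_j,\operatorname{conv}\{x_i\}_{i\neq j})$. A softmax code is an $n$-point configuration in $S^{d-1}$ maximizing $\delta$; $\operatorname{SMC}(d,n)$ denotes the set of all $n$-point softmax codes in $S^{d-1}$. For $W=\{w_k\}_{k\in[n]}$ in $S^{d-1}$ and $\tau>0$, $\mathcal{L}^{(\tau)}_{\mathrm{CE}}(W,W):=\frac{1}{n}\sum_{k=1}^n-\log\Big(\frac{\exp(\langle w_k,w_k\rangle/\tau)}{\sum_{j=1}^n\exp(\langle w_j,w_k\rangle/\tau)}\Big)$. A softmax code is low-entropy (with parameter $p$) if it consists of the vertices of a $p$-point origin-centered regular simplex inscribed in the unit sphere together with the vertices of an orthoplex (points $\pm u_1,\ldots,\pm u_r$ for orthonormal $u_1,\dots,u_r$), where the two lie in mutually orthogonal subspaces that together span $\mathbb{R}^d$. A softmax code is high-entropy (with parameter $p$) if it consists of the vertices of mutually orthogonal origin-centered regular simplices inscribed in the unit sphere, each having $p$ or $p+1$ points,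 whose spans together span $\mathbb{R}^d$. *)

theory Defs
  imports "HOL-Analysis.Analysis"
begin

definition on_sphere :: "nat \<Rightarrow> (nat \<Rightarrow> 'a::euclidean_space) \<Rightarrow> bool" where
  "on_sphere n W \<longleftrightarrow> (\<forall>i<n. norm (W i) = 1)"

definition delta :: "nat \<Rightarrow> (nat \<Rightarrow> 'a::euclidean_space) \<Rightarrow> real" where
  "delta n W = Min ((\<lambda>j. infdist (W j) (convex hull (W ` ({..<n} - {j})))) ` {..<n})"

definition is_SMC :: "nat \<Rightarrow> (nat \<Rightarrow> 'a::euclidean_space) \<Rightarrow> bool" where
  "is_SMC n W \<longleftrightarrow> on_sphere n W \<and> (\<forall>V :: nat \<Rightarrow> 'a. on_sphere n V \<longrightarrow> delta n V \<le> delta n W)"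

definition CE_loss :: "real \<Rightarrow> nat \<Rightarrow> (nat \<Rightarrow> 'a::euclidean_space) \<Rightarrow> real" where
  "CE_loss \<tau> n W = (1 / real n) * (\<Sum>k<n. - ln (exp (inner (W k) (W k) / \<tau>) /
       (\<Sum>j<n. exp (inner (W j) (W k) / \<tau>))))"

definition CE_minimizer_on_SMC :: "real \<Rightarrow> nat \<Rightarrow> (nat \<Rightarrow> 'a::euclidean_space) \<Rightarrow> bool" where
  "CE_minimizer_on_SMC \<tau> n W \<longleftrightarrow> is_SMC n W \<and> (\<forall>V :: nat \<Rightarrow> 'a. is_SMC n V \<longrightarrow> CE_loss \<tau> n W \<le> CE_loss \<tau> n V)"

definition reg_simplex :: "nat \<Rightarrow> 'a::euclidean_space set \<Rightarrow> bool" where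
  "reg_simplex p S \<longleftrightarrow> finite S \<and> card S = p \<and> (\<forall>x\<in>S. norm x = 1) \<and> (\<Sum>x\<in>S. x) = 0 \<and>
     (\<exists>c. \<forall>x\<in>S. \<forall>y\<in>S. x \<noteq> y \<longrightarrow> dist x y = c)"

definition orthoplex :: "'a::euclidean_space set \<Rightarrow> bool" where
  "orthoplex Q \<longleftrightarrow> (\<exists>U. finite U \<and> (\<forall>u\<in>U. norm u = 1) \<and> pairwise orthogonal U \<and>
     Q = U \<union> uminus ` U)"

definition low_entropy :: "nat \<Rightarrow> nat \<Rightarrow> (nat \<Rightarrow> 'a::euclidean_space) \<Rightarrow> bool" where
  "low_entropy p n W \<longleftrightarrow> inj_on W {..<n} \<and>
     (\<exists>S Q. reg_simplex p S \<and> orthoplex Q \<and> W ` {..<n} = S \<union> Q \<and>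
        (\<forall>x\<in>span S. \<forall>y\<in>span Q. orthogonal x y) \<and> span (S \<union> Q) = UNIV)"

definition high_entropy :: "nat \<Rightarrow> nat \<Rightarrow> (nat \<Rightarrow> 'a::euclidean_space) \<Rightarrow> bool" where
  "high_entropy p n W \<longleftrightarrow> inj_on W {..<n} \<and>
     (\<exists>F. finite F \<and> (\<forall>S\<in>F. reg_simplex p S \<or> reg_simplex (Suc p) S) \<and>
        (\<forall>A\<in>F. \<forall>B\<in>F. A \<noteq> B \<longrightarrow> (\<forall>x\<in>span A. \<forall>y\<in>span B. orthogonal x y)) \<and>
        W ` {..<n} = \<Union>F \<and> span (\<Union>F) = UNIV)"

end

theory Submission
  imports Defs "HOL-Real_Asymp.Real_Asymp"
begin

text \<open>
  For \<open>d + 2 \<le> n \<le> 2 d\<close> the maximal value of \<open>\<delta>\<close> is 1: the common point \<open>z\<close> of the two hulls of a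
  Radon partition is at squared distance \<open>1 - |z|\<^sup>2\<close> from the vertices of either part, on average.
  Softmax codes are therefore the unit configurations with pairwise nonpositive inner products.
  Splitting off minimal positive linear relations, such a configuration decomposes into
  \<open>k = n - d\<close> mutually orthogonal groups of sizes \<open>m\<^sub>1, \<dots>, m\<^sub>k \<ge> 2\<close>.
  With \<open>s = 1/\<tau>\<close>, the tangent inequality for log-sum-exp shows that for given sizes the loss is minimal
  exactly when every group is a regular simplex, and every choice of sizes is realised in this way. The loss is
  then an affine function of \<open>\<phi>\<^sub>s(m\<^sub>1) + \<dots> + \<phi>\<^sub>s(m\<^sub>k)\<close>, where
  \<open>\<phi>\<^sub>s(m) = m ln (e\<^sup>s + (m-1) exp (-s/(m-1)) + n - m)\<close>.
  As \<open>s \<rightarrow> \<infinity>\<close>, \<open>\<phi>\<^sub>s(m) = m s + m (n-m) exp (-s) + \<dots>\<close>, so the sum of the \<open>m\<^sub>i\<^sup>2\<close> is to be maximised and at most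
  one size exceeds 2; as \<open>s \<rightarrow> 0\<close>, \<open>\<phi>\<^sub>s(m) = m ln n + (m + 1 + 1/(m-1)) s\<^sup>2/(2n) + \<dots>\<close>, so the sum of the
  \<open>1/(m\<^sub>i-1)\<close> is to be minimised and the sizes differ by at most 1. The thresholds are uniform since
  only finitely many exchanges of one point between two groups are compared.
\<close>

section \<open>The maximal value of \<open>delta\<close> and the codes attaining it\<close>

text \<open>The parallel axis identity: on expanding the squares, the mixed terms add up to
  \<open>- 2 * (z \<bullet> z)\<close> because \<open>z\<close> is the weighted mean.\<close>

lemma sum_norm_diff_barycentre:
  fixes W :: "'i \<Rightarrow> 'a::real_inner"
  assumes "finite I" and unit: "\<And>i. i \<in> I \<Longrightarrow> norm (W i) = 1"
    and "sum l I = 1" and z: "(\<Sum>i\<in>I. l i *\<^sub>R W i) = z"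
  shows "(\<Sum>i\<in>I. l i * (norm (W i - z))\<^sup>2) = 1 - (norm z)\<^sup>2"
proof -
  have "l i * (norm (W i - z))\<^sup>2 = l i - 2 * (l i * (W i \<bullet> z)) + l i * (norm z)\<^sup>2" if "i \<in> I" for i
    using unit[OF that] by (simp add: power2_norm_eq_inner inner_diff norm_eq_1 inner_commute algebra_simps)
  then have "(\<Sum>i\<in>I. l i * (norm (W i - z))\<^sup>2)
      = sum l I - 2 * (\<Sum>i\<in>I. l i * (W i \<bullet> z)) + sum l I * (norm z)\<^sup>2"
    by (simp add: sum.distrib sum_subtractf sum_distrib_left sum_distrib_right)
  also have "(\<Sum>i\<in>I. l i * (W i \<bullet> z)) = z \<bullet> z"
    unfolding z[symmetric] by (simp add: inner_sum_left)
  finally show ?thesis using assms(3) by (simp add: power2_norm_eq_inner)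
qed

lemma delta_le:
  assumes "j < n" "y \<in> convex hull (W ` ({..<n} - {j}))"
  shows "delta n W \<le> dist (W j) y"
proof -
  have "delta n W \<le> infdist (W j) (convex hull (W ` ({..<n} - {j})))"
    unfolding delta_def using assms(1) by (intro Min_le) auto
  also have "\<dots> \<le> dist (W j) y" by (rule infdist_le[OF assms(2)])
  finally show ?thesis .
qed

text \<open>The hull over \<open>J\<close> avoids every index of \<open>I\<close>, so each
  \<open>W i\<close> with \<open>i\<close> in \<open>I\<close> has distance at least
  \<open>delta n W\<close> from \<open>z\<close>. The parallel axis identity evaluates the mean of
  the squared distances.\<close>

lemma delta_le_sqrt:
  fixes W :: "nat \<Rightarrow> 'a::euclidean_space"
  assumes "on_sphere n W" "I \<subseteq> {..<n}" "J \<subseteq> {..<n}" "I \<inter> J = {}" "0 < delta n W"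
    and "inj_on W {..<n}" "z \<in> convex hull (W ` I)" "z \<in> convex hull (W ` J)"
  shows "(delta n W)\<^sup>2 \<le> 1 - (norm z)\<^sup>2"
proof -
  have fI: "finite I" using assms(2) finite_subset by blast
  have injI: "inj_on W I" using assms(2,6) inj_on_subset by blast
  obtain u where u: "\<forall>x\<in>W ` I. 0 \<le> u x" "sum u (W ` I) = 1" "(\<Sum>x\<in>W ` I. u x *\<^sub>R x) = z"
    using assms(7) fI by (auto simp: convex_hull_finite)
  define l where "l i = u (W i)" for i
  have l: "\<forall>i\<in>I. 0 \<le> l i" "sum l I = 1" "(\<Sum>i\<in>I. l i *\<^sub>R W i) = z"
    using u injI by (auto simp: l_def sum.reindex)
  have "(delta n W)\<^sup>2 \<le> (norm (W i - z))\<^sup>2" if "i \<in> I" for i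
  proof -
    have "W ` J \<subseteq> W ` ({..<n} - {i})" using assms(3,4) that by auto
    then have "z \<in> convex hull (W ` ({..<n} - {i}))" using assms(8) hull_mono by blast
    then have "delta n W \<le> dist (W i) z" using assms(2) that by (intro delta_le) auto
    then show ?thesis using assms(5) by (simp add: dist_norm power_mono)
  qed
  then have "(\<Sum>i\<in>I. l i * (delta n W)\<^sup>2) \<le> (\<Sum>i\<in>I. l i * (norm (W i - z))\<^sup>2)"
    using l(1) by (intro sum_mono mult_left_mono) auto
  also have "\<dots> = 1 - (norm z)\<^sup>2"
    using fI l assms(1,2) by (intro sum_norm_diff_barycentre) (auto simp: on_sphere_def)
  finally show ?thesis using l(2) by (simp add: sum_distrib_right[symmetric])
qed

lemma delta_pos_imp_inj_on:
  assumes "0 < delta n W"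
  shows "inj_on W {..<n}"
proof (rule inj_onI, rule ccontr)
  fix i j assume ij: "i \<in> {..<n}" "j \<in> {..<n}" "W i = W j" "i \<noteq> j"
  then have "W i \<in> convex hull (W ` ({..<n} - {i}))"
    by (intro hull_inc) auto
  then have "delta n W \<le> dist (W i) (W i)" using ij by (intro delta_le) auto
  with assms show False by simp
qed

text \<open>\<open>delta\<close> removes indices while Radon's theorem splits a set of points;
  injectivity transports the two parts to disjoint index sets.\<close>

lemma obtain_radon_indices:
  fixes W :: "nat \<Rightarrow> 'a::euclidean_space"
  assumes "DIM('a) + 2 \<le> n" "inj_on W {..<n}"
  obtains I J z where "I \<subseteq> {..<n}" "J \<subseteq> {..<n}" "I \<inter> J = {}"
    "z \<in> convex hull (W ` I)" "z \<in> convex hull (W ` J)"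
proof -
  let ?S = "W ` {..<n}"
  have "affine_dependent ?S"
    using assms by (intro affine_dependent_biggerset) (auto simp: card_image)
  then obtain M P where MP: "M \<subseteq> ?S" "P \<subseteq> ?S" "M \<inter> P = {}"
    "convex hull M \<inter> convex hull P \<noteq> {}"
    using Radon[of ?S] by blast
  then obtain z where z: "z \<in> convex hull M" "z \<in> convex hull P" by blast
  have M: "M = W ` (W -` M \<inter> {..<n})" and P: "P = W ` (W -` P \<inter> {..<n})" using MP by auto
  show thesis
    by (rule that[of "W -` M \<inter> {..<n}" "W -` P \<inter> {..<n}" z])
      (use MP(3) z M[symmetric] P[symmetric] in auto)
qed

lemma delta_le_1:
  fixes W :: "nat \<Rightarrow> 'a::euclidean_space"
  assumes "DIM('a) + 2 \<le> n" "on_sphere n W"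
  shows "delta n W \<le> 1"
proof (cases "0 < delta n W")
  case True
  then have inj: "inj_on W {..<n}" by (rule delta_pos_imp_inj_on)
  obtain I J z where "I \<subseteq> {..<n}" "J \<subseteq> {..<n}" "I \<inter> J = {}"
    "z \<in> convex hull (W ` I)" "z \<in> convex hull (W ` J)"
    using obtain_radon_indices[OF assms(1) inj] .
  from delta_le_sqrt[OF assms(2) this(1-3) True inj this(4,5)]
  have "(delta n W)\<^sup>2 \<le> 1" by (smt (verit) zero_le_power2)
  then show ?thesis using power2_le_imp_le[of "delta n W" 1] by simp
qed auto

text \<open>The distance bound forces the Radon point to be the origin, and one of the two hulls
  avoids \<open>i\<close>. If \<open>t = W i \<bullet> W j\<close> were positive, the point
  \<open>t *\<^sub>R W j\<close> between the origin and \<open>W j\<close> would have squared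
  distance \<open>1 - t * t\<close> from \<open>W i\<close>.\<close>

lemma inner_nonpos_if_delta_ge_1:
  fixes W :: "nat \<Rightarrow> 'a::euclidean_space"
  assumes n: "DIM('a) + 2 \<le> n" and sph: "on_sphere n W" and ge: "1 \<le> delta n W"
    and ij: "i < n" "j < n" "i \<noteq> j"
  shows "W i \<bullet> W j \<le> 0"
proof (rule ccontr)
  assume pos: "\<not> W i \<bullet> W j \<le> 0"
  have d0: "0 < delta n W" using ge by simp
  then have inj: "inj_on W {..<n}" by (rule delta_pos_imp_inj_on)
  obtain I J z where IJ: "I \<subseteq> {..<n}" "J \<subseteq> {..<n}" "I \<inter> J = {}"
    "z \<in> convex hull (W ` I)" "z \<in> convex hull (W ` J)"
    using obtain_radon_indices[OF n inj] .
  have "1 \<le> (delta n W)\<^sup>2" using ge by (simp add: one_le_power)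
  with delta_le_sqrt[OF sph IJ(1-3) d0 inj IJ(4,5)] have "(norm z)\<^sup>2 \<le> 0" by linarith
  then have z: "z = 0" by simp
  let ?C = "convex hull (W ` ({..<n} - {i}))"
  have "0 \<in> ?C"
  proof (cases "i \<in> I")
    case True
    then have "W ` J \<subseteq> W ` ({..<n} - {i})" using IJ by auto
    then show ?thesis using IJ(5) z hull_mono by blast
  next
    case False
    then have "W ` I \<subseteq> W ` ({..<n} - {i})" using IJ by auto
    then show ?thesis using IJ(4) z hull_mono by blast
  qed
  moreover have "W j \<in> ?C" using ij by (intro hull_inc) auto
  moreover define t where "t = W i \<bullet> W j"
  have nn: "W i \<bullet> W i = 1" "W j \<bullet> W j = 1" using sph ij by (auto simp: on_sphere_def norm_eq_1)
  have t1: "0 < t" "t \<le> 1"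
    using pos norm_cauchy_schwarz[of "W i" "W j"] sph ij by (auto simp: t_def on_sphere_def)
  ultimately have "(1 - t) *\<^sub>R 0 + t *\<^sub>R W j \<in> ?C"
    by (intro convexD_alt[OF convex_convex_hull]) auto
  then have "delta n W \<le> dist (W i) (t *\<^sub>R W j)" using ij by (intro delta_le) auto
  with ge have "1 \<le> dist (W i) (t *\<^sub>R W j)" by simp
  then have "1 \<le> (dist (W i) (t *\<^sub>R W j))\<^sup>2" by (simp add: one_le_power)
  also have "\<dots> = 1 - 2 * t * t + t * t"
    by (simp add: dist_norm power2_norm_eq_inner inner_diff inner_commute nn t_def[symmetric] algebra_simps)
  finally have "t * t \<le> 0" by simp
  then show False using t1 by (simp add: mult_le_0_iff)
qed

text \<open>The hull of the other points lies in the half-space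
  \<open>W j \<bullet> y \<le> 0\<close>, all of whose points have distance at least 1 from
  \<open>W j\<close>.\<close>

lemma delta_ge_1_if_inner_nonpos:
  fixes W :: "nat \<Rightarrow> 'a::euclidean_space"
  assumes "2 \<le> n" and sph: "on_sphere n W"
    and np: "\<And>i j. i < n \<Longrightarrow> j < n \<Longrightarrow> i \<noteq> j \<Longrightarrow> W i \<bullet> W j \<le> 0"
  shows "1 \<le> delta n W"
proof -
  have "1 \<le> infdist (W j) (convex hull (W ` ({..<n} - {j})))" if j: "j < n" for j
  proof -
    \<comment> \<open>The hull must be nonempty, since \<open>infdist\<close> to the empty set is
      0.\<close>
    have "\<exists>i. i < n \<and> i \<noteq> j"
      by (rule exI[of _ "if j = 0 then 1 else 0"]) (use assms(1) in auto)
    then have ne: "convex hull (W ` ({..<n} - {j})) \<noteq> {}" by auto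
    have "convex hull (W ` ({..<n} - {j})) \<subseteq> {y. W j \<bullet> y \<le> 0}"
      using np j by (intro hull_minimal convex_halfspace_le) auto
    then have "1 \<le> dist (W j) y" if "y \<in> convex hull (W ` ({..<n} - {j}))" for y
    proof -
      have "W j \<bullet> y \<le> 0" using that \<open>_ \<subseteq> _\<close> by blast
      moreover have "(dist (W j) y)\<^sup>2 = 1 - 2 * (W j \<bullet> y) + y \<bullet> y"
        using sph j by (simp add: on_sphere_def norm_eq_1 dist_norm power2_norm_eq_inner inner_diff inner_commute)
      ultimately have "1\<^sup>2 \<le> (dist (W j) y)\<^sup>2" using inner_ge_zero[of y] by (simp del: inner_ge_zero)
      then show ?thesis by (rule power2_le_imp_le) simp
    qed
    then show ?thesis unfolding infdist_notempty[OF ne] by (intro cINF_greatest[OF ne])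
  qed
  moreover have "{..<n} \<noteq> {}" using assms(1) by (simp add: lessThan_empty_iff)
  ultimately show ?thesis unfolding delta_def by (subst Min_ge_iff) auto
qed

section \<open>Linear relations and the splitting into orthogonal groups\<close>

text \<open>Coefficients are attached to indices, so a vector repeated at two indices already gives
  a relation.\<close>

lemma nontrivial_relation_if_dim_less_card:
  fixes W :: "'i \<Rightarrow> 'a::euclidean_space"
  assumes "finite A" and "dim (W ` A) < card A"
  obtains u where "\<exists>i\<in>A. u i \<noteq> 0" "(\<Sum>i\<in>A. u i *\<^sub>R W i) = 0"
proof (cases "inj_on W A")
  case True
  then have "dependent (W ` A)"
    using assms dim_eq_card_independent[of "W ` A"] by (auto simp: card_image)
  then obtain u where u: "\<exists>v\<in>W ` A. u v \<noteq> 0" "(\<Sum>v\<in>W ` A. u v *\<^sub>R v) = 0"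
    using assms(1) by (auto simp: dependent_finite)
  show thesis
    by (rule that[of "u \<circ> W"]) (use u True in \<open>auto simp: sum.reindex\<close>)
next
  case False
  then obtain i j where ij: "i \<in> A" "j \<in> A" "i \<noteq> j" "W i = W j"
    by (auto simp: inj_on_def)
  let ?u = "\<lambda>k. (if k = i then 1 else 0) - (if k = j then 1 else 0) :: real"
  have "(\<Sum>k\<in>A. ?u k *\<^sub>R W k) = W i - W j"
    using ij assms(1) by (simp add: algebra_simps sum_subtractf if_distrib[of "\<lambda>x. x *\<^sub>R _"] cong: if_cong)
  then show thesis
    by (intro that[of ?u]) (use ij in \<open>auto intro!: bexI[of _ i]\<close>)
qed

text \<open>Moving the negative part of the relation to the other side writes one vector
  \<open>x\<close> as two positive combinations with disjoint supports. Then
  \<open>x \<bullet> x\<close> is a sum of nonpositive terms, so \<open>x = 0\<close>, and either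
  nonempty side is a positive relation.\<close>

lemma positive_relation:
  fixes W :: "'i \<Rightarrow> 'a::real_inner"
  assumes "finite A" and np: "\<And>i j. i \<in> A \<Longrightarrow> j \<in> A \<Longrightarrow> i \<noteq> j \<Longrightarrow> W i \<bullet> W j \<le> 0"
    and u: "\<exists>i\<in>A. u i \<noteq> 0" "(\<Sum>i\<in>A. u i *\<^sub>R W i) = 0"
  obtains D c where "D \<subseteq> A" "D \<noteq> {}" "\<And>i. i \<in> D \<Longrightarrow> 0 < c i" "(\<Sum>i\<in>D. c i *\<^sub>R W i) = 0"
proof -
  define P where "P = {i \<in> A. 0 < u i}"
  define N where "N = {i \<in> A. u i < 0}"
  define x where "x = (\<Sum>i\<in>P. u i *\<^sub>R W i)"
  have fin: "finite P" "finite N" using assms(1) by (auto simp: P_def N_def)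
  have "(\<Sum>i\<in>A. u i *\<^sub>R W i) = (\<Sum>i\<in>P \<union> N. u i *\<^sub>R W i)"
    using assms(1) by (intro sum.mono_neutral_right) (auto simp: P_def N_def)
  also have "\<dots> = x + (\<Sum>i\<in>N. u i *\<^sub>R W i)"
    unfolding x_def using fin by (intro sum.union_disjoint) (auto simp: P_def N_def)
  finally have xN: "x = (\<Sum>i\<in>N. (- u i) *\<^sub>R W i)"
    using u(2) by (simp add: sum_negf eq_neg_iff_add_eq_0)
  have "x \<bullet> x = x \<bullet> (\<Sum>i\<in>N. (- u i) *\<^sub>R W i)" using xN by simp
  also have "\<dots> = (\<Sum>i\<in>P. \<Sum>j\<in>N. (u i * - u j) * (W i \<bullet> W j))"
    unfolding x_def inner_sum_left inner_sum_right
    by (subst sum.swap, intro sum.cong refl) simp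
  also have "\<dots> \<le> 0"
    by (intro sum_nonpos mult_nonneg_nonpos mult_nonneg_nonneg np) (auto simp: P_def N_def)
  finally have "x \<bullet> x = 0" using inner_ge_zero[of x] by linarith
  then have x0: "x = 0" by simp
  show thesis
  proof (cases "P = {}")
    case True
    then show thesis using u(1) xN x0
      by (intro that[of N "\<lambda>i. - u i"]) (auto simp: P_def N_def not_less_iff_gr_or_eq)
  next
    case False
    then show thesis using x0
      by (intro that[of P u]) (auto simp: P_def x_def)
  qed
qed

text \<open>The support of a positive relation of minimal size is orthogonal to all the other vectors,
  because nonpositive numbers that sum to zero vanish.\<close>

lemma minimal_positive_relation:
  fixes W :: "'i \<Rightarrow> 'a::euclidean_space"
  assumes "finite A" and unit: "\<And>i. i \<in> A \<Longrightarrow> norm (W i) = 1"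
    and np: "\<And>i j. i \<in> A \<Longrightarrow> j \<in> A \<Longrightarrow> i \<noteq> j \<Longrightarrow> W i \<bullet> W j \<le> 0"
    and "dim (W ` A) < card A"
  obtains D where "D \<subseteq> A" "2 \<le> card D" "card D \<le> Suc (dim (W ` D))"
    "\<forall>i\<in>D. \<forall>j\<in>A - D. W i \<bullet> W j = 0"
proof -
  define R where "R D \<longleftrightarrow> D \<subseteq> A \<and> D \<noteq> {} \<and> (\<exists>c. (\<forall>i\<in>D. 0 < c i) \<and> (\<Sum>i\<in>D. c i *\<^sub>R W i) = 0)" for D
  have ex: "\<exists>D\<subseteq>B. R D" if B: "B \<subseteq> A" "dim (W ` B) < card B" for B
  proof -
    have fB: "finite B" using B(1) assms(1) by (rule finite_subset)
    obtain u where u: "\<exists>i\<in>B. u i \<noteq> 0" "(\<Sum>i\<in>B. u i *\<^sub>R W i) = 0"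
      using nontrivial_relation_if_dim_less_card[OF fB B(2)] .
    show ?thesis
    proof (rule positive_relation[OF fB _ u])
      show "W i \<bullet> W j \<le> 0" if "i \<in> B" "j \<in> B" "i \<noteq> j" for i j
        using that B(1) np by blast
    next
      fix D c
      assume "D \<subseteq> B" "D \<noteq> {}" "\<And>i. i \<in> D \<Longrightarrow> 0 < c i" "(\<Sum>i\<in>D. c i *\<^sub>R W i) = 0"
      then show ?thesis
        using B(1) by (intro exI[of _ D]) (auto simp: R_def)
    qed
  qed
  obtain D where D: "R D" and min: "\<And>D'. R D' \<Longrightarrow> card D \<le> card D'"
  proof -
    obtain D0 where "R D0" using ex[of A] assms(4) by blast
    then show thesis using ex_has_least_nat[of R D0 card] that by blast
  qed
  then obtain c where c: "\<And>i. i \<in> D \<Longrightarrow> 0 < c i" "(\<Sum>i\<in>D. c i *\<^sub>R W i) = 0"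
    and DA: "D \<subseteq> A" "D \<noteq> {}" by (auto simp: R_def)
  have fD: "finite D" using DA(1) assms(1) by (rule finite_subset)
  obtain i0 where i0: "i0 \<in> D" using DA(2) by blast
  have "D \<noteq> {i0}"
  proof
    assume "D = {i0}"
    then show False using c(1)[of i0] c(2) unit[of i0] DA by auto
  qed
  then have "\<not> card D \<le> 1" using i0 fD by (auto simp: card_le_Suc0_iff_eq)
  then have card2: "2 \<le> card D" by simp
  \<comment> \<open>A dependence among the vectors left after removing \<open>i0\<close> would yield
    a positive relation with smaller support, so they are independent.\<close>
  have "card (D - {i0}) \<le> dim (W ` (D - {i0}))"
  proof (rule ccontr)
    assume "\<not> ?thesis"
    then obtain D' where D': "D' \<subseteq> D - {i0}" "R D'"
      using ex[of "D - {i0}"] DA by auto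
    have "card D' < card D" using D'(1) i0 fD by (intro psubset_card_mono) auto
    with min[OF D'(2)] show False by simp
  qed
  also have "\<dots> \<le> dim (W ` D)" by (intro dim_subset) auto
  finally have dimD: "card D \<le> Suc (dim (W ` D))" using i0 fD by simp
  have orth: "W i \<bullet> W j = 0" if "i \<in> D" "j \<in> A - D" for i j
  proof -
    have "(\<Sum>i\<in>D. - (c i * (W i \<bullet> W j))) = - ((\<Sum>i\<in>D. c i *\<^sub>R W i) \<bullet> W j)"
      by (simp add: inner_sum_left sum_negf)
    also have "\<dots> = 0" using c(2) by simp
    finally have sum0: "(\<Sum>i\<in>D. - (c i * (W i \<bullet> W j))) = 0" .
    have nn: "0 \<le> - (c i * (W i \<bullet> W j))" if "i \<in> D" for i
    proof -
      have "W i \<bullet> W j \<le> 0" using that \<open>j \<in> A - D\<close> DA np by blast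
      then show ?thesis using c(1)[OF that] by (simp add: mult_le_0_iff)
    qed
    have "- (c i * (W i \<bullet> W j)) = 0"
      using sum0 nn fD that(1) sum_nonneg_eq_0_iff[of D "\<lambda>i. - (c i * (W i \<bullet> W j))"] by blast
    then show ?thesis using c(1)[OF that(1)] by simp
  qed
  show thesis using orth by (intro that[OF DA(1) card2 dimD]) simp
qed

text \<open>Splitting off a minimal support \<open>D\<close> lowers the excess of cardinality over
  dimension by at most 1, as its span is orthogonal to the rest and has dimension at least
  \<open>card D - 1\<close>. Labels run from 0 to \<open>k\<close>; label 0 takes whatever remains
  at the end.\<close>

lemma orthogonal_partition:
  fixes W :: "'i \<Rightarrow> 'a::euclidean_space"
  assumes "finite A" and "\<And>i. i \<in> A \<Longrightarrow> norm (W i) = 1"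
    and "\<And>i j. i \<in> A \<Longrightarrow> j \<in> A \<Longrightarrow> i \<noteq> j \<Longrightarrow> W i \<bullet> W j \<le> 0"
    and "dim (W ` A) + Suc k \<le> card A"
  shows "\<exists>g. g ` A \<subseteq> {..k} \<and> (\<forall>c\<le>k. 2 \<le> card {i \<in> A. g i = c}) \<and>
    (\<forall>i\<in>A. \<forall>j\<in>A. g i \<noteq> g j \<longrightarrow> W i \<bullet> W j = 0)"
  using assms
proof (induction k arbitrary: A)
  case 0
  \<comment> \<open>Positive dimension leaves at least two indices for the last group.\<close>
  have "dim (W ` A) \<noteq> 0"
  proof
    assume "dim (W ` A) = 0"
    then have *: "W i = 0" if "i \<in> A" for i using that by (auto simp: dim_eq_0)
    have "A \<noteq> {}" using 0(4) by auto
    then obtain i where "i \<in> A" by blast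
    with *[of i] 0(2)[of i] show False by simp
  qed
  then show ?case using 0(4) by (intro exI[of _ "\<lambda>_. 0"]) (simp del: dim_eq_0, simp add: image_subset_iff)
next
  case (Suc k)
  have "dim (W ` A) < card A" using Suc.prems(4) by simp
  from minimal_positive_relation[OF Suc.prems(1-3) this]
  obtain D where D: "D \<subseteq> A" "2 \<le> card D" "card D \<le> Suc (dim (W ` D))"
    "\<forall>i\<in>D. \<forall>j\<in>A - D. W i \<bullet> W j = 0"
    .
  have "dim (W ` D \<union> W ` (A - D)) = dim (W ` D) + dim (W ` (A - D))"
    using D(4) by (intro dim_orthogonal_sum) auto
  moreover have "W ` D \<union> W ` (A - D) = W ` A" using D(1) by auto
  moreover have "card (A - D) = card A - card D" "card D \<le> card A"
    using D(1) Suc.prems(1) by (auto simp: card_Diff_subset finite_subset card_mono)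
  ultimately have le: "dim (W ` (A - D)) + Suc k \<le> card (A - D)"
    using Suc.prems(4) D(3) by simp
  have "\<exists>g. g ` (A - D) \<subseteq> {..k} \<and> (\<forall>c\<le>k. 2 \<le> card {i \<in> A - D. g i = c}) \<and>
      (\<forall>i\<in>A - D. \<forall>j\<in>A - D. g i \<noteq> g j \<longrightarrow> W i \<bullet> W j = 0)"
    by (rule Suc.IH) (use Suc.prems(1-3) le in auto)
  then obtain g where g: "g ` (A - D) \<subseteq> {..k}" "\<forall>c\<le>k. 2 \<le> card {i \<in> A - D. g i = c}"
    "\<forall>i\<in>A - D. \<forall>j\<in>A - D. g i \<noteq> g j \<longrightarrow> W i \<bullet> W j = 0"
    by blast
  define h where "h i = (if i \<in> D then Suc k else g i)" for i
  have "2 \<le> card {i \<in> A. h i = c}" if "c \<le> Suc k" for c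
  proof (cases "c = Suc k")
    case True
    then have "{i \<in> A. h i = c} = D" using g(1) D(1) by (auto simp: h_def)
    then show ?thesis using D(2) by simp
  next
    case False
    then have "{i \<in> A. h i = c} = {i \<in> A - D. g i = c}" by (auto simp: h_def)
    then show ?thesis using g(2) that False by simp
  qed
  moreover have "h ` A \<subseteq> {..Suc k}" using g(1) by (force simp: h_def)
  moreover have "W i \<bullet> W j = 0" if "i \<in> A" "j \<in> A" "h i \<noteq> h j" for i j
    using that g(3) D(4) by (auto simp: h_def inner_commute split: if_splits)
  ultimately show ?case by blast
qed

section \<open>Regular simplices and their Gram matrices\<close>

lemma inner_span_eq_0:
  fixes S T :: "'a::real_inner set"
  assumes "\<And>x y. x \<in> S \<Longrightarrow> y \<in> T \<Longrightarrow> x \<bullet> y = 0" "x \<in> span S" "y \<in> span T"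
  shows "x \<bullet> y = 0"
proof -
  have "orthogonal s y" if "s \<in> S" for s
    using assms(1,3) that by (intro orthogonal_to_span[of y T]) (auto simp: orthogonal_def)
  then have "orthogonal y x"
    using assms(2) by (intro orthogonal_to_span[of x S]) (auto simp: orthogonal_commute)
  then show ?thesis by (simp add: orthogonal_def inner_commute)
qed

text \<open>A regular simplex is lifted by one dimension by adding an apex \<open>u\<close> orthogonal to it and
  rescaling its vertices within the parallel hyperplane at height \<open>-1/(q+1)\<close>.\<close>

lemma regular_simplex_in_span:
  fixes B :: "'a::real_inner set"
  assumes "finite B" "B \<noteq> {}" "pairwise orthogonal B" "\<And>b. b \<in> B \<Longrightarrow> norm b = 1"
    and "finite I" "card I = Suc (card B)"
  shows "\<exists>v. (\<forall>i\<in>I. v i \<in> span B \<and> v i \<bullet> v i = 1) \<and>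
    (\<forall>i\<in>I. \<forall>j\<in>I. i \<noteq> j \<longrightarrow> v i \<bullet> v j = - 1 / real (card B))"
  using assms
proof (induction B arbitrary: I rule: finite_ne_induct)
  case (singleton u)
  then have "card I = 2" by simp
  then obtain i j where I: "I = {i, j}" "i \<noteq> j" by (auto simp: card_2_iff)
  have "u \<bullet> u = 1" using singleton by (simp add: norm_eq_1)
  then show ?case
    using I by (intro exI[of _ "\<lambda>k. if k = i then u else - u"]) (auto simp: span_base span_neg)
next
  case (insert u F)
  define q where "q = real (card F)"
  have q: "0 < q" using insert.hyps by (simp add: q_def card_gt_0_iff)
  have uu: "u \<bullet> u = 1" using insert.prems(2) by (simp add: norm_eq_1)
  obtain i0 where i0: "i0 \<in> I" using insert.prems(4) by fastforce
  have "card (I - {i0}) = Suc (card F)"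
    using insert.prems i0 insert.hyps by simp
  moreover have "pairwise orthogonal F" using insert.prems(1) by (simp add: pairwise_insert)
  ultimately have "\<exists>v. (\<forall>i\<in>I - {i0}. v i \<in> span F \<and> v i \<bullet> v i = 1) \<and>
    (\<forall>i\<in>I - {i0}. \<forall>j\<in>I - {i0}. i \<noteq> j \<longrightarrow> v i \<bullet> v j = - 1 / real (card F))"
    using insert.prems by (intro insert.IH) auto
  then obtain v where "\<forall>i\<in>I - {i0}. v i \<in> span F \<and> v i \<bullet> v i = 1"
    "\<forall>i\<in>I - {i0}. \<forall>j\<in>I - {i0}. i \<noteq> j \<longrightarrow> v i \<bullet> v j = - 1 / real (card F)"
    by (elim exE conjE) (rule that)
  then have v: "\<And>i. i \<in> I - {i0} \<Longrightarrow> v i \<in> span F \<and> v i \<bullet> v i = 1"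
    "\<And>i j. i \<in> I - {i0} \<Longrightarrow> j \<in> I - {i0} \<Longrightarrow> i \<noteq> j \<Longrightarrow> v i \<bullet> v j = - 1 / q"
    by (simp_all add: q_def)
  have uv: "u \<bullet> v i = 0" "v i \<bullet> u = 0" if "i \<in> I - {i0}" for i
  proof -
    have "orthogonal u b" if "b \<in> F" for b
      by (rule pairwiseD[OF insert.prems(1)]) (use insert.hyps(3) that in auto)
    then have "orthogonal u (v i)" using v(1)[OF that] by (blast intro: orthogonal_to_span)
    then show "u \<bullet> v i = 0" "v i \<bullet> u = 0" by (simp_all add: orthogonal_def inner_commute)
  qed
  \<comment> \<open>This \<open>c\<close> gives the lifted vertices norm 1. Their mutual inner
    products are then \<open>1 / (q + 1)\<^sup>2 - (c * c) / q\<close>, the value required in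
    \<open>q + 1\<close> dimensions.\<close>
  define c where "c = sqrt (1 - 1 / (q + 1)\<^sup>2)"
  have "1 / (q + 1)\<^sup>2 \<le> 1" using q by (simp add: divide_le_eq_1 one_le_power)
  then have c: "c * c = 1 - 1 / (q + 1)\<^sup>2" by (simp add: c_def)
  have c_q: "1 / (q + 1)\<^sup>2 - (c * c) / q = - 1 / (q + 1)"
    unfolding c using q by (simp add: divide_simps power2_eq_square) (simp add: algebra_simps)
  define w where "w i = (if i = i0 then u else (- 1 / (q + 1)) *\<^sub>R u + c *\<^sub>R v i)" for i
  have cardB: "real (card (insert u F)) = q + 1" using insert.hyps by (simp add: q_def)
  have "w i \<in> span (insert u F)" if "i \<in> I" for i
  proof -
    have "v i \<in> span (insert u F)" if "i \<noteq> i0"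
      using v(1)[of i] \<open>i \<in> I\<close> that span_mono[of F "insert u F"] by auto
    then show ?thesis
      by (simp add: w_def span_base span_diff span_scale)
  qed
  moreover have "w i \<bullet> w i = 1" if "i \<in> I" for i
    using that v(1)[of i] uv[of i] c
    by (auto simp: w_def uu inner_diff power2_eq_square algebra_simps)
  moreover have "w i \<bullet> w j = - 1 / real (card (insert u F))" if "i \<in> I" "j \<in> I" "i \<noteq> j" for i j
    unfolding cardB using that v(2)[of i j] uv[of i] uv[of j] c_q
    by (auto simp: w_def uu inner_diff power2_eq_square algebra_simps)
  ultimately show ?case by blast
qed

definition fiber :: "nat \<Rightarrow> (nat \<Rightarrow> nat) \<Rightarrow> nat \<Rightarrow> nat set" where
  "fiber n g c = {i. i < n \<and> g i = c}"

text \<open>Groups are encoded by labels below \<open>k\<close>, so that moving a point is a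
  function update.\<close>

definition partitions :: "nat \<Rightarrow> nat \<Rightarrow> (nat \<Rightarrow> nat) \<Rightarrow> bool" where
  "partitions n k g \<longleftrightarrow> (\<forall>i<n. g i < k) \<and> (\<forall>c<k. 2 \<le> card (fiber n g c))"

text \<open>The Gram matrix of mutually orthogonal regular simplices, one per group:
  \<open>m\<close> unit vectors with sum 0 and equal inner products between distinct ones have
  \<open>- 1 / (m - 1)\<close> as that common value.\<close>

definition simplex_gram :: "nat \<Rightarrow> (nat \<Rightarrow> nat) \<Rightarrow> nat \<Rightarrow> nat \<Rightarrow> real" where
  "simplex_gram n g i j = (if i = j then 1 else if g i = g j
     then - 1 / (real (card (fiber n g (g i))) - 1) else 0)"

lemma finite_fiber [simp]: "finite (fiber n g c)"
  by (simp add: fiber_def)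

lemma obtain_fiber_representatives:
  assumes "partitions n k g"
  obtains r where "\<forall>c<k. r c \<in> fiber n g c" "card ({..<n} - r ` {..<k}) = n - k"
proof -
  have card2: "\<And>c. c < k \<Longrightarrow> 2 \<le> card (fiber n g c)"
    using assms by (auto simp: partitions_def)
  have "\<exists>i. i \<in> fiber n g c" if "c < k" for c
    using card2[OF that] by (metis card.empty ex_in_conv not_numeral_le_zero)
  then obtain r where r: "\<And>c. c < k \<Longrightarrow> r c \<in> fiber n g c" by metis
  have "inj_on r {..<k}" using r by (intro inj_on_inverseI[of _ g]) (auto simp: fiber_def)
  moreover have "r ` {..<k} \<subseteq> {..<n}" using r by (auto simp: fiber_def)
  ultimately have "card ({..<n} - r ` {..<k}) = n - k"
    by (simp add: card_Diff_subset card_image)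
  with r show thesis by (intro that) auto
qed

text \<open>The indices left after omitting one per group are matched with the standard basis. A
  group of \<open>m\<close> indices thereby receives \<open>m - 1\<close> basis vectors, whose span
  holds a regular simplex with \<open>m\<close> vertices; distinct groups receive disjoint sets of
  basis vectors.\<close>

lemma ex_simplex_gram:
  assumes "partitions n k g" "n = k + DIM('a::euclidean_space)"
  shows "\<exists>V :: nat \<Rightarrow> 'a. \<forall>i<n. \<forall>j<n. V i \<bullet> V j = simplex_gram n g i j"
proof -
  have g: "\<And>i. i < n \<Longrightarrow> g i < k" and card2: "\<And>c. c < k \<Longrightarrow> 2 \<le> card (fiber n g c)"
    using assms(1) by (auto simp: partitions_def)
  obtain r where "\<forall>c<k. r c \<in> fiber n g c" "card ({..<n} - r ` {..<k}) = n - k"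
    using obtain_fiber_representatives[OF assms(1)] .
  moreover define N where "N = {..<n} - r ` {..<k}"
  ultimately have r: "\<And>c. c < k \<Longrightarrow> r c \<in> fiber n g c"
    and "card N = card (Basis :: 'a set)"
    using assms(2) by auto
  then obtain h where h: "bij_betw h N (Basis :: 'a set)"
    using finite_same_card_bij[of N "Basis :: 'a set"] by (auto simp: N_def)
  define B where "B c = h ` (fiber n g c - {r c})" for c
  have sub: "fiber n g c - {r c} \<subseteq> N" if "c < k" for c
    using that r by (auto simp: fiber_def N_def)
  have BB: "B c \<subseteq> Basis" if "c < k" for c
    using sub[OF that] h by (auto simp: B_def bij_betw_def)
  have cardB: "Suc (card (B c)) = card (fiber n g c)" if "c < k" for c
  proof -
    have "card (B c) = card (fiber n g c - {r c})"
      unfolding B_def using sub[OF that] h by (intro card_image) (auto simp: bij_betw_def inj_on_subset)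
    then show ?thesis using r[OF that] card2[OF that] by simp
  qed
  have "\<exists>v. (\<forall>i\<in>fiber n g c. v i \<in> span (B c) \<and> v i \<bullet> v i = 1) \<and>
      (\<forall>i\<in>fiber n g c. \<forall>j\<in>fiber n g c. i \<noteq> j \<longrightarrow> v i \<bullet> v j = - 1 / real (card (B c)))" if "c < k" for c
  proof (rule regular_simplex_in_span)
    show "finite (B c)" by (simp add: B_def)
    then show "B c \<noteq> {}" using cardB[OF that] card2[OF that] by auto
    show "pairwise orthogonal (B c)"
      by (rule pairwise_subset[OF _ BB[OF that]]) (auto simp: pairwise_def orthogonal_def inner_Basis)
    show "norm b = 1" if "b \<in> B c" for b using BB[OF \<open>c < k\<close>] that by auto
  qed (simp_all add: cardB[OF that])
  then obtain v where v: "\<And>c i. c < k \<Longrightarrow> i \<in> fiber n g c \<Longrightarrow> v c i \<in> span (B c) \<and> v c i \<bullet> v c i = 1"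
    "\<And>c i j. c < k \<Longrightarrow> i \<in> fiber n g c \<Longrightarrow> j \<in> fiber n g c \<Longrightarrow> i \<noteq> j \<Longrightarrow>
      v c i \<bullet> v c j = - 1 / real (card (B c))" by metis
  have "v (g i) i \<bullet> v (g j) j = simplex_gram n g i j" if "i < n" "j < n" for i j
  proof (cases "g i = g j")
    case True
    have ij: "i \<in> fiber n g (g i)" "j \<in> fiber n g (g i)" using that True by (auto simp: fiber_def)
    have "real (card (B (g i))) = real (card (fiber n g (g i))) - 1"
      using cardB[OF g[OF that(1)]] by linarith
    then show ?thesis
      using v(1)[OF g[OF that(1)] ij(1)] v(2)[OF g[OF that(1)] ij] True by (auto simp: simplex_gram_def)
  next
    case False
    have ne: "x \<bullet> y = 0" if "x \<in> B (g i)" "y \<in> B (g j)" for x y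
    proof -
      obtain a b where ab: "x = h a" "y = h b" "a \<in> fiber n g (g i) - {r (g i)}" "b \<in> fiber n g (g j) - {r (g j)}"
        using \<open>x \<in> _\<close> \<open>y \<in> _\<close> by (auto simp: B_def)
      have "a \<in> N" "b \<in> N" using ab sub g \<open>i < n\<close> \<open>j < n\<close> by blast+
      moreover have "a \<noteq> b" using ab False by (auto simp: fiber_def)
      ultimately have "x \<noteq> y" "x \<in> Basis" "y \<in> Basis"
        using h ab(1,2) by (auto simp: bij_betw_def inj_on_def)
      then show ?thesis by (simp add: inner_Basis)
    qed
    have "v (g i) i \<bullet> v (g j) j = 0"
      by (rule inner_span_eq_0[OF ne]) (use v(1) g that in \<open>auto simp: fiber_def\<close>)
    then show ?thesis using False by (auto simp: simplex_gram_def)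
  qed
  then show ?thesis by (intro exI[of _ "\<lambda>i. v (g i) i"]) simp
qed

section \<open>The tangent inequality for log-sum-exp\<close>

lemma exp_eq_tangent_imp_eq:
  fixes t u :: real
  assumes "exp u = exp t * (1 + u - t)"
  shows "u = t"
proof -
  have "exp (u - t) = 1 + (u - t)" using assms by (simp add: exp_diff)
  then have "ln (exp (u - t)) = exp (u - t) - 1" unfolding ln_exp by simp
  then have "exp (u - t) = 1" by (rule ln_eq_minus_one[OF exp_gt_zero])
  then show ?thesis by simp
qed

lemma exp_ge_tangent:
  fixes t u :: real
  shows "exp t * (1 + u - t) \<le> exp u"
proof -
  have "exp t * (1 + (u - t)) \<le> exp t * exp (u - t)" by (intro mult_left_mono exp_ge_add_one_self) auto
  then show ?thesis by (simp add: exp_add[symmetric] algebra_simps)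
qed

text \<open>Here \<open>t\<close> is the derivative of log-sum-exp at \<open>y\<close> in the
  direction \<open>x - y\<close>, the mean of \<open>x j - y j\<close> under the softmax weights.
  Jensen's inequality for \<open>exp\<close> gives the bound, and strict convexity settles
  equality.\<close>

lemma ln_sum_exp_ge_tangent:
  fixes x y :: "'i \<Rightarrow> real"
  assumes "finite J" "J \<noteq> {}"
  defines "Z \<equiv> (\<Sum>j\<in>J. exp (y j))"
  defines "t \<equiv> (\<Sum>j\<in>J. exp (y j) / Z * (x j - y j))"
  shows "ln Z + t \<le> ln (\<Sum>j\<in>J. exp (x j))"
    and "ln (\<Sum>j\<in>J. exp (x j)) = ln Z + t \<Longrightarrow> \<forall>j\<in>J. x j - y j = t"
proof -
  have Z: "0 < Z" unfolding Z_def using assms(1,2) by (intro sum_pos) auto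
  have X: "0 < (\<Sum>j\<in>J. exp (x j))" using assms(1,2) by (intro sum_pos) auto
  \<comment> \<open>The weighted gaps between \<open>exp\<close> and its tangent at
    \<open>t\<close>; the linear terms cancel in their sum.\<close>
  define e where "e j = exp (y j) / Z * (exp (x j - y j) - exp t * (1 + (x j - y j) - t))" for j
  have e: "0 \<le> e j" for j
    unfolding e_def using exp_ge_tangent[of t "x j - y j"] Z by (intro mult_nonneg_nonneg) auto
  have p1: "(\<Sum>j\<in>J. exp (y j) / Z) = 1"
    using Z by (simp add: sum_divide_distrib[symmetric] Z_def[symmetric])
  have "e j = exp (x j) / Z - exp t * (1 - t) * (exp (y j) / Z) - exp t * (exp (y j) / Z * (x j - y j))" for j
    using Z by (simp add: e_def exp_diff field_simps)
  then have "sum e J = (\<Sum>j\<in>J. exp (x j)) / Z - exp t * (1 - t) * (\<Sum>j\<in>J. exp (y j) / Z) - exp t * t"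
    by (simp add: sum_subtractf sum_distrib_left[symmetric] sum_divide_distrib[symmetric] t_def[symmetric]
      del: times_divide_eq_left times_divide_eq_right)
  then have sum_e: "sum e J = (\<Sum>j\<in>J. exp (x j)) / Z - exp t"
    by (simp add: p1 algebra_simps)
  have "exp t \<le> (\<Sum>j\<in>J. exp (x j)) / Z" using sum_nonneg[of J e] e sum_e by simp
  then have "t \<le> ln ((\<Sum>j\<in>J. exp (x j)) / Z)" using X Z by (simp add: ln_ge_iff)
  then show "ln Z + t \<le> ln (\<Sum>j\<in>J. exp (x j))" using X Z by (simp add: ln_div)
  assume "ln (\<Sum>j\<in>J. exp (x j)) = ln Z + t"
  then have "exp (ln (\<Sum>j\<in>J. exp (x j))) = exp (ln Z) * exp t" by (simp add: exp_add)
  then have "sum e J = 0" using X Z sum_e by simp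
  then have e0: "\<forall>j\<in>J. e j = 0" using e assms(1) by (simp add: sum_nonneg_eq_0_iff)
  show "\<forall>j\<in>J. x j - y j = t"
  proof
    fix j assume "j \<in> J"
    then have "exp (x j - y j) - exp t * (1 + (x j - y j) - t) = 0"
      using e0 Z unfolding e_def by simp
    then show "x j - y j = t" by (rule exp_eq_tangent_imp_eq[OF iffD1[OF right_minus_eq]])
  qed
qed

section \<open>The loss as a function of the Gram matrix\<close>

text \<open>Defined for arbitrary matrices, so that the Gram matrix of a code can be compared with
  \<open>simplex_gram\<close> before the latter is realised by vectors.\<close>

definition lse :: "nat \<Rightarrow> real \<Rightarrow> (nat \<Rightarrow> nat \<Rightarrow> real) \<Rightarrow> real" where
  "lse n s M = (\<Sum>i<n. ln (\<Sum>j<n. exp (s * M i j)))"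

text \<open>The logarithm of the row sum of a point in a group of \<open>m\<close>: the point
  itself, the \<open>m - 1\<close> other vertices of its simplex, and \<open>n - m\<close>
  orthogonal points.\<close>

definition fiber_log :: "nat \<Rightarrow> real \<Rightarrow> nat \<Rightarrow> real" where
  "fiber_log n s m = ln (exp s + (real m - 1) * exp (- s / (real m - 1)) + (real n - real m))"

text \<open>Unit norms make every numerator equal to \<open>exp (1 / \<tau>)\<close>, so minimising
  the loss is minimising \<open>lse\<close> at \<open>1 / \<tau>\<close>.\<close>

lemma CE_loss_eq_lse:
  assumes "on_sphere n W" "0 < n"
  shows "CE_loss \<tau> n W = (lse n (1 / \<tau>) (\<lambda>i j. W i \<bullet> W j)) / real n - 1 / \<tau>"
proof -
  have "- ln (exp (W k \<bullet> W k / \<tau>) / (\<Sum>j<n. exp (W j \<bullet> W k / \<tau>)))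
      = ln (\<Sum>j<n. exp (1 / \<tau> * (W k \<bullet> W j))) - 1 / \<tau>" if "k < n" for k
  proof -
    have "0 < (\<Sum>j<n. exp (W j \<bullet> W k / \<tau>))" using assms(2) by (intro sum_pos) (auto simp: lessThan_empty_iff)
    then show ?thesis
      using assms(1) that by (simp add: on_sphere_def norm_eq_1 ln_div inner_commute)
  qed
  then have "CE_loss \<tau> n W = 1 / real n * (\<Sum>k<n. ln (\<Sum>j<n. exp (1 / \<tau> * (W k \<bullet> W j))) - 1 / \<tau>)"
    unfolding CE_loss_def by simp
  then show ?thesis
    using assms(2) by (simp add: lse_def sum_subtractf diff_divide_distrib right_diff_distrib)
qed

lemma card_fiber_ge_2:
  assumes "partitions n k g" "i < n"
  shows "2 \<le> card (fiber n g (g i))"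
  using assms by (auto simp: partitions_def)

lemma sum_over_fibers:
  assumes "partitions n k g"
  shows "(\<Sum>i<n. f i) = (\<Sum>c<k. \<Sum>i\<in>fiber n g c. f i)"
proof -
  have "(\<Sum>i<n. f i) = (\<Sum>c<k. sum f {i \<in> {..<n}. g i = c})"
    using assms by (intro sum.group[symmetric]) (auto simp: partitions_def)
  then show ?thesis by (simp add: fiber_def)
qed

lemma exp_simplex_gram_row_sum:
  assumes "partitions n k g" "i < n"
  defines "m \<equiv> card (fiber n g (g i))"
  shows "(\<Sum>j<n. exp (s * simplex_gram n g i j))
    = exp s + (real m - 1) * exp (- s / (real m - 1)) + (real n - real m)"
proof -
  let ?F = "fiber n g (g i)"
  have m: "2 \<le> m" using card_fiber_ge_2[OF assms(1,2)] by (simp add: m_def)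
  have iF: "i \<in> ?F" using assms(2) by (simp add: fiber_def)
  have sub: "?F \<subseteq> {..<n}" by (auto simp: fiber_def)
  have "(\<Sum>j<n. exp (s * simplex_gram n g i j)) =
      (\<Sum>j\<in>{..<n} - ?F. exp (s * simplex_gram n g i j)) + (\<Sum>j\<in>?F. exp (s * simplex_gram n g i j))"
    using sub by (intro sum.subset_diff) auto
  also have "(\<Sum>j\<in>{..<n} - ?F. exp (s * simplex_gram n g i j)) = (\<Sum>j\<in>{..<n} - ?F. 1)"
    using iF by (intro sum.cong) (auto simp: fiber_def simplex_gram_def)
  also have "\<dots> = real n - real m"
    using sub card_mono[OF _ sub] by (simp add: card_Diff_subset m_def)
  also have "(\<Sum>j\<in>?F. exp (s * simplex_gram n g i j)) =
      exp (s * simplex_gram n g i i) + (\<Sum>j\<in>?F - {i}. exp (s * simplex_gram n g i j))"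
    using iF by (intro sum.remove) auto
  also have "(\<Sum>j\<in>?F - {i}. exp (s * simplex_gram n g i j)) = (\<Sum>j\<in>?F - {i}. exp (- s / (real m - 1)))"
    by (intro sum.cong) (auto simp: fiber_def simplex_gram_def m_def)
  also have "\<dots> = (real m - 1) * exp (- s / (real m - 1))"
    using iF m by (simp add: m_def of_nat_diff)
  finally show ?thesis by (simp add: simplex_gram_def)
qed

lemma lse_simplex_gram:
  assumes "partitions n k g"
  shows "lse n s (simplex_gram n g) =
    (\<Sum>c<k. real (card (fiber n g c)) * fiber_log n s (card (fiber n g c)))"
proof -
  have "lse n s (simplex_gram n g) = (\<Sum>i<n. fiber_log n s (card (fiber n g (g i))))"
    using exp_simplex_gram_row_sum[OF assms] by (simp add: lse_def fiber_log_def)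
  also have "\<dots> = (\<Sum>c<k. \<Sum>i\<in>fiber n g c. fiber_log n s (card (fiber n g (g i))))"
    by (rule sum_over_fibers[OF assms])
  also have "\<dots> = (\<Sum>c<k. \<Sum>i\<in>fiber n g c. fiber_log n s (card (fiber n g c)))"
    by (intro sum.cong) (auto simp: fiber_def)
  finally show ?thesis by simp
qed

text \<open>The tangent bound at the simplex Gram matrix: the first-order terms add up to a nonnegative
  combination of the squared norms of the vector sums over the groups.\<close>

lemma lse_ge_simplex_gram:
  fixes W :: "nat \<Rightarrow> 'a::real_inner"
  assumes g: "partitions n k g" and "0 < s"
    and unit: "\<And>i. i < n \<Longrightarrow> norm (W i) = 1"
    and orth: "\<And>i j. i < n \<Longrightarrow> j < n \<Longrightarrow> g i \<noteq> g j \<Longrightarrow> W i \<bullet> W j = 0"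
  shows "lse n s (simplex_gram n g) \<le> lse n s (\<lambda>i j. W i \<bullet> W j)"
    and "lse n s (\<lambda>i j. W i \<bullet> W j) = lse n s (simplex_gram n g) \<Longrightarrow>
      \<forall>i<n. \<forall>j<n. W i \<bullet> W j = simplex_gram n g i j"
proof -
  let ?G = "simplex_gram n g"
  define Z where "Z i = (\<Sum>j<n. exp (s * ?G i j))" for i
  define t where "t i = (\<Sum>j<n. exp (s * ?G i j) / Z i * (s * (W i \<bullet> W j) - s * ?G i j))" for i
  define S where "S c = (\<Sum>j\<in>fiber n g c. W j)" for c
  define m where "m c = real (card (fiber n g c)) - 1" for c
  \<comment> \<open>This is \<open>s\<close> times the softmax weight of an off-diagonal entry
    within group \<open>c\<close>; note that \<open>m c\<close> is the group size minus 1.\<close>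
  define a where "a c = s * exp (- s / m c) / (exp s + m c * exp (- s / m c) + (real n - real (card (fiber n g c))))" for c
  have m1: "1 \<le> m c" if "c < k" for c
    using g that by (fastforce simp: partitions_def m_def)
  have gk: "g i < k" if "i < n" for i using g that by (simp add: partitions_def)
  have WW: "W i \<bullet> W i = 1" if "i < n" for i using unit[OF that] by (simp add: norm_eq_1)
  have Z: "Z i = exp s + m (g i) * exp (- s / m (g i)) + (real n - real (card (fiber n g (g i))))" if "i < n" for i
    using exp_simplex_gram_row_sum[OF g that] by (simp add: Z_def m_def)
  have Zpos: "0 < Z i" if "i < n" for i
    unfolding Z_def using that by (intro sum_pos) auto
  have t: "t i = a (g i) * (W i \<bullet> S (g i))" if i: "i < n" for i
  proof -
    let ?F = "fiber n g (g i)"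
    have iF: "i \<in> ?F" using i by (simp add: fiber_def)
    have m0: "0 < m (g i)" using m1[OF gk[OF i]] by simp
    have a: "a (g i) = s * exp (- s / m (g i)) / Z i" by (simp add: a_def Z[OF i])
    \<comment> \<open>Outside the group and on the diagonal the two matrices agree.\<close>
    have "t i = (\<Sum>j\<in>?F - {i}. exp (s * ?G i j) / Z i * (s * (W i \<bullet> W j) - s * ?G i j))"
      unfolding t_def
    proof (rule sum.mono_neutral_right)
      show "?F - {i} \<subseteq> {..<n}" by (auto simp: fiber_def)
      have "W i \<bullet> W j = ?G i j" if "j < n" "j \<notin> ?F - {i}" for j
        using that orth[OF i, of j] WW[OF i] i by (auto simp: fiber_def simplex_gram_def)
      then show "\<forall>j\<in>{..<n} - (?F - {i}). exp (s * ?G i j) / Z i * (s * (W i \<bullet> W j) - s * ?G i j) = 0"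
        by simp
    qed simp
    also have "\<dots> = (\<Sum>j\<in>?F - {i}. a (g i) * (W i \<bullet> W j + 1 / m (g i)))"
    proof (rule sum.cong)
      fix j assume "j \<in> ?F - {i}"
      then have "?G i j = - 1 / m (g i)" by (auto simp: fiber_def simplex_gram_def m_def)
      then show "exp (s * ?G i j) / Z i * (s * (W i \<bullet> W j) - s * ?G i j) = a (g i) * (W i \<bullet> W j + 1 / m (g i))"
        by (simp add: a algebra_simps add_divide_distrib)
    qed simp
    also have "\<dots> = a (g i) * ((\<Sum>j\<in>?F - {i}. W i \<bullet> W j) + (\<Sum>j\<in>?F - {i}. 1 / m (g i)))"
      by (simp add: sum_distrib_left[symmetric] sum.distrib)
    \<comment> \<open>This 1 stands in for \<open>W i \<bullet> W i\<close> and completes the sum to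
      the whole group.\<close>
    also have "(\<Sum>j\<in>?F - {i}. 1 / m (g i)) = 1"
      using iF m0 card_fiber_ge_2[OF g i] by (simp add: m_def of_nat_diff)
    also have "(\<Sum>j\<in>?F - {i}. W i \<bullet> W j) + 1 = (\<Sum>j\<in>?F. W i \<bullet> W j)"
      using iF WW[OF i] by (simp add: sum.remove[of ?F i])
    finally show ?thesis by (simp add: S_def inner_sum_right)
  qed
  have a0: "0 \<le> a c" if c: "c < k" for c
  proof -
    have "card (fiber n g c) \<le> n" using card_mono[of "{..<n}" "fiber n g c"] by (auto simp: fiber_def)
    then show ?thesis using m1[OF c] \<open>0 < s\<close>
      unfolding a_def by (intro divide_nonneg_nonneg add_nonneg_nonneg) auto
  qed
  have "(\<Sum>i<n. t i) = (\<Sum>c<k. \<Sum>i\<in>fiber n g c. a c * (W i \<bullet> S c))"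
    unfolding sum_over_fibers[OF g] using t by (intro sum.cong) (auto simp: fiber_def)
  also have "\<dots> = (\<Sum>c<k. a c * (S c \<bullet> S c))"
    by (intro sum.cong refl) (simp add: sum_distrib_left[symmetric] inner_sum_left[symmetric] S_def[symmetric])
  also have "0 \<le> \<dots>" using a0 by (intro sum_nonneg mult_nonneg_nonneg) auto
  finally have t_nonneg: "0 \<le> (\<Sum>i<n. t i)" .
  define f where "f i = ln (\<Sum>j<n. exp (s * (W i \<bullet> W j)))" for i
  have f: "ln (Z i) + t i \<le> f i"
    "f i = ln (Z i) + t i \<Longrightarrow> \<forall>j<n. s * (W i \<bullet> W j) - s * ?G i j = t i" if "i < n" for i
  proof -
    have J: "finite {..<n}" "{..<n} \<noteq> {}" using that by auto
    note tangent = ln_sum_exp_ge_tangent[OF J, where y = "\<lambda>j. s * ?G i j" and x = "\<lambda>j. s * (W i \<bullet> W j)",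
      folded Z_def, folded t_def f_def]
    show "ln (Z i) + t i \<le> f i" by (rule tangent(1))
    show "\<forall>j<n. s * (W i \<bullet> W j) - s * ?G i j = t i" if "f i = ln (Z i) + t i"
      using tangent(2)[OF that] by blast
  qed
  have sumf: "(\<Sum>i<n. f i - (ln (Z i) + t i)) = lse n s (\<lambda>i j. W i \<bullet> W j) - lse n s ?G - (\<Sum>i<n. t i)"
    by (simp add: lse_def f_def Z_def sum_subtractf sum.distrib)
  have nonneg: "0 \<le> (\<Sum>i<n. f i - (ln (Z i) + t i))" using f(1) by (intro sum_nonneg) auto
  then show "lse n s ?G \<le> lse n s (\<lambda>i j. W i \<bullet> W j)" using sumf t_nonneg by linarith
  assume "lse n s (\<lambda>i j. W i \<bullet> W j) = lse n s ?G"
  then have "(\<Sum>i<n. f i - (ln (Z i) + t i)) = 0" using sumf nonneg t_nonneg by linarith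
  then have "\<forall>i\<in>{..<n}. f i - (ln (Z i) + t i) = 0"
    using f(1) by (subst (asm) sum_nonneg_eq_0_iff) auto
  then have eq: "s * (W i \<bullet> W j) - s * ?G i j = t i" if "i < n" "j < n" for i j
    using f(2)[OF that(1)] that by auto
  show "\<forall>i<n. \<forall>j<n. W i \<bullet> W j = ?G i j"
  proof (intro allI impI)
    fix i j assume ij: "i < n" "j < n"
    \<comment> \<open>Equality makes the difference of the rows constant, and on the diagonal it
      vanishes.\<close>
    have "t i = 0" using eq[OF ij(1) ij(1)] WW[OF ij(1)] by (simp add: simplex_gram_def)
    then show "W i \<bullet> W j = ?G i j" using eq[OF ij] \<open>0 < s\<close> by simp
  qed
qed

section \<open>Exchange inequalities at low and high temperature\<close>

text \<open>With \<open>q = m - 1\<close> and \<open>u = exp (- s)\<close>, factoring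
  \<open>exp s\<close> out of the logarithm leaves
  \<open>ln (1 + q * u powr (1 + 1 / q) + (n - m) * u)\<close>. The middle term is of smaller order
  than \<open>u\<close>.\<close>

lemma fiber_log_at_top:
  assumes "2 \<le> m"
  shows "((\<lambda>s. (real m * fiber_log n s m - real m * s) * exp s) \<longlongrightarrow> real m * (real n - real m)) at_top"
proof -
  define q where "q = real m - 1"
  define r where "r = real n - real m"
  define p where "p = 1 / q"
  have q: "0 < q" "0 < p" using assms by (simp_all add: q_def p_def)
  have "((\<lambda>u. ln (1 + q * u powr (1 + p) + r * u) / u) \<longlongrightarrow> r) (at_right 0)"
    using q by real_asymp
  moreover have "filterlim (\<lambda>s::real. exp (- s)) (at_right 0) at_top"
    by real_asymp
  ultimately have "((\<lambda>s. ln (1 + q * exp (- s) powr (1 + p) + r * exp (- s)) / exp (- s)) \<longlongrightarrow> r) at_top"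
    by (rule filterlim_compose)
  then have lim: "((\<lambda>s. real m * (ln (1 + q * exp (- s) powr (1 + p) + r * exp (- s)) / exp (- s))) \<longlongrightarrow> real m * r) at_top"
    by (intro tendsto_intros)
  have "eventually (\<lambda>s. 0 < 1 + q * exp (- s) powr (1 + p) + r * exp (- s)) at_top"
    using q by real_asymp
  then have "eventually (\<lambda>s. real m * (ln (1 + q * exp (- s) powr (1 + p) + r * exp (- s)) / exp (- s))
      = (real m * fiber_log n s m - real m * s) * exp s) at_top"
  proof eventually_elim
    case (elim s)
    let ?E = "1 + q * exp (- s) powr (1 + p) + r * exp (- s)"
    have "exp s * exp (- s) powr (1 + p) = exp (- s / q)"
      by (simp add: powr_def exp_add[symmetric] algebra_simps p_def)
    then have "exp s * ?E = exp s + q * exp (- s / q) + r"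
      by (simp add: algebra_simps exp_add[symmetric])
    then have "fiber_log n s m = ln (exp s * ?E)" by (simp add: fiber_log_def q_def r_def)
    also have "\<dots> = s + ln ?E" using elim by (subst ln_mult) auto
    finally show ?case by (simp add: exp_minus divide_inverse algebra_simps)
  qed
  from Lim_transform_eventually[OF lim this] show ?thesis by (simp add: r_def)
qed

text \<open>With \<open>q = m - 1\<close>, the first-order terms of \<open>exp s\<close> and
  \<open>q * exp (- s / q)\<close> cancel, so the argument of the logarithm is
  \<open>n + (1 + 1 / q) * s\<^sup>2 / 2\<close> up to higher order. The factor
  \<open>m = q + 1\<close> turns \<open>1 + 1 / q\<close> into
  \<open>m + 1 + 1 / (m - 1)\<close>.\<close>

lemma fiber_log_at_right_0:
  assumes "2 \<le> m" "0 < n"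
  shows "((\<lambda>s. (real m * fiber_log n s m - real m * ln (real n)) / s\<^sup>2) \<longlongrightarrow>
    (real m + 1 + 1 / (real m - 1)) / (2 * real n)) (at_right 0)"
proof -
  define q where "q = real m - 1"
  have q: "0 < q" "real m = q + 1" using assms by (simp_all add: q_def)
  have n: "0 < real n" using assms by simp
  have "((\<lambda>s. (ln (exp s + q * exp (- s / q) + (real n - (q + 1))) - ln (real n)) / s\<^sup>2)
      \<longlongrightarrow> (1 + 1 / q) / (2 * real n)) (at_right 0)"
    using q(1) n by real_asymp (simp add: field_simps)
  then have "((\<lambda>s. (q + 1) * ((ln (exp s + q * exp (- s / q) + (real n - (q + 1))) - ln (real n)) / s\<^sup>2))
      \<longlongrightarrow> (q + 1) * ((1 + 1 / q) / (2 * real n))) (at_right 0)"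
    by (rule tendsto_mult_left)
  moreover have "(q + 1) * ((1 + 1 / q) / (2 * real n)) = (real m + 1 + 1 / (real m - 1)) / (2 * real n)"
    using q n by (simp add: field_simps)
  ultimately have "((\<lambda>s. (q + 1) * ((ln (exp s + q * exp (- s / q) + (real n - (q + 1))) - ln (real n)) / s\<^sup>2))
      \<longlongrightarrow> (real m + 1 + 1 / (real m - 1)) / (2 * real n)) (at_right 0)"
    by (simp only:)
  then show ?thesis
    by (simp add: fiber_log_def q(2) right_diff_distrib)
qed

text \<open>The exchange preserves \<open>a + b\<close>, so the leading terms \<open>m * s\<close>
  cancel, and the scaled difference tends to \<open>2 * (a - b + 1)\<close>. The bound
  \<open>3 \<le> b\<close> keeps \<open>b - 1\<close> in the range of the asymptotics.\<close>

lemma eventually_less_at_top_if_card_le: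
  assumes "3 \<le> b" "b \<le> a"
  shows "eventually (\<lambda>s. real (Suc a) * fiber_log n s (Suc a) + real (b - 1) * fiber_log n s (b - 1)
    < real a * fiber_log n s a + real b * fiber_log n s b) at_top"
proof -
  define F where "F m s = (real m * fiber_log n s m - real m * s) * exp s" for m s
  have lim: "(F m \<longlongrightarrow> real m * (real n - real m)) at_top" if "2 \<le> m" for m
    unfolding F_def using fiber_log_at_top[OF that] .
  have "((\<lambda>s. F a s + F b s - (F (Suc a) s + F (b - 1) s)) \<longlongrightarrow>
      real a * (real n - real a) + real b * (real n - real b) -
      (real (Suc a) * (real n - real (Suc a)) + real (b - 1) * (real n - real (b - 1)))) at_top"
    using assms by (intro tendsto_intros lim) auto
  moreover have "0 < real a * (real n - real a) + real b * (real n - real b) -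
      (real (Suc a) * (real n - real (Suc a)) + real (b - 1) * (real n - real (b - 1)))"
    using assms by (simp add: of_nat_diff algebra_simps)
  ultimately have "eventually (\<lambda>s. 0 < F a s + F b s - (F (Suc a) s + F (b - 1) s)) at_top"
    by (rule order_tendstoD(1))
  then show ?thesis
  proof eventually_elim
    case (elim s)
    then have "0 < (real a * fiber_log n s a + real b * fiber_log n s b
      - (real (Suc a) * fiber_log n s (Suc a) + real (b - 1) * fiber_log n s (b - 1))) * exp s"
      using assms by (simp add: F_def of_nat_diff algebra_simps)
    then show ?case by (simp add: zero_less_mult_iff)
  qed
qed

text \<open>All parts of the expansion that are affine in the size cancel because
  \<open>a + b\<close> is preserved; the strict convexity of \<open>1 / (m - 1)\<close>
  decides.\<close>

lemma eventually_less_at_right_0_if_card_diff_ge_2: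
  assumes "2 \<le> b" "b + 2 \<le> a" "0 < n"
  shows "eventually (\<lambda>s. real (Suc b) * fiber_log n s (Suc b) + real (a - 1) * fiber_log n s (a - 1)
    < real a * fiber_log n s a + real b * fiber_log n s b) (at_right 0)"
proof -
  define F where "F m s = (real m * fiber_log n s m - real m * ln (real n)) / s\<^sup>2" for m s
  define L where "L m = (real m + 1 + 1 / (real m - 1)) / (2 * real n)" for m
  have lim: "(F m \<longlongrightarrow> L m) (at_right 0)" if "2 \<le> m" for m
    unfolding F_def L_def using fiber_log_at_right_0[OF that assms(3)] .
  have "((\<lambda>s. F a s + F b s - (F (Suc b) s + F (a - 1) s)) \<longlongrightarrow>
      L a + L b - (L (Suc b) + L (a - 1))) (at_right 0)"
    using assms by (intro tendsto_intros lim) auto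
  moreover have "0 < L a + L b - (L (Suc b) + L (a - 1))"
  proof -
    \<comment> \<open>The denominators \<open>b - 1\<close>, \<open>b\<close>, \<open>a - 2\<close>,
      \<open>a - 1\<close> become \<open>x - 1\<close>, \<open>x\<close>, \<open>y\<close>,
      \<open>y + 1\<close>, and \<open>b + 2 \<le> a\<close> becomes
      \<open>x \<le> y\<close>.\<close>
    define x where "x = real b"
    define y where "y = real a - 2"
    have xy: "2 \<le> x" "x \<le> y" using assms by (auto simp: x_def y_def)
    have "1 / y - 1 / (y + 1) = 1 / (y * (y + 1))" using xy by (simp add: field_simps)
    also have "\<dots> < 1 / ((x - 1) * x)"
      using xy by (intro divide_strict_left_mono mult_strict_mono mult_pos_pos) auto
    also have "\<dots> = 1 / (x - 1) - 1 / x" using xy by (simp add: field_simps)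
    finally have "0 < 1 / (y + 1) + 1 / (x - 1) - (1 / x + 1 / y)" by simp
    then have "0 < (1 / (y + 1) + 1 / (x - 1) - (1 / x + 1 / y)) / (2 * real n)" using assms by simp
    also have "\<dots> = L a + L b - (L (Suc b) + L (a - 1))"
      using assms by (simp add: L_def x_def y_def of_nat_diff add_divide_distrib diff_divide_distrib algebra_simps)
    finally show ?thesis .
  qed
  ultimately have "eventually (\<lambda>s. 0 < F a s + F b s - (F (Suc b) s + F (a - 1) s)) (at_right 0)"
    by (rule order_tendstoD(1))
  moreover have "eventually (\<lambda>s::real. 0 < s) (at_right 0)" by (rule eventually_at_right_less)
  ultimately show ?thesis
  proof eventually_elim
    case (elim s)
    have "F a s + F b s - (F (Suc b) s + F (a - 1) s) = (real a * fiber_log n s a + real b * fiber_log n s b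
      - (real (Suc b) * fiber_log n s (Suc b) + real (a - 1) * fiber_log n s (a - 1))) / s\<^sup>2"
      using assms by (simp add: F_def of_nat_diff add_divide_distrib[symmetric] diff_divide_distrib[symmetric] algebra_simps)
    then show ?case using elim by (simp add: zero_less_divide_iff)
  qed
qed

section \<open>Softmax codes and the minimisers among them\<close>

lemma simplex_gram_nonpos:
  assumes "partitions n k g" "i < n" "i \<noteq> j"
  shows "simplex_gram n g i j \<le> 0"
  using card_fiber_ge_2[OF assms(1,2)] assms(3) by (auto simp: simplex_gram_def)

lemma ex_partitions:
  assumes "0 < k" "2 * k \<le> n"
  shows "\<exists>g. partitions n k g"
proof -
  have "2 \<le> card (fiber n (\<lambda>i. i mod k) c)" if "c < k" for c
  proof -
    have "{c, c + k} \<subseteq> fiber n (\<lambda>i. i mod k) c" using that assms by (auto simp: fiber_def)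
    then have "card {c, c + k} \<le> card (fiber n (\<lambda>i. i mod k) c)" by (intro card_mono) auto
    then show ?thesis using assms(1) by simp
  qed
  then show ?thesis using assms(1) by (intro exI[of _ "\<lambda>i. i mod k"]) (auto simp: partitions_def)
qed

lemma nonpos_if_simplex_gram:
  fixes V :: "nat \<Rightarrow> 'a::euclidean_space"
  assumes "partitions n k g" "\<forall>i<n. \<forall>j<n. V i \<bullet> V j = simplex_gram n g i j"
  shows "on_sphere n V" "\<And>i j. i < n \<Longrightarrow> j < n \<Longrightarrow> i \<noteq> j \<Longrightarrow> V i \<bullet> V j \<le> 0"
  using assms simplex_gram_nonpos[OF assms(1)]
  by (auto simp: on_sphere_def norm_eq_1 simplex_gram_def)

text \<open>The value 1 is attained, since \<open>n \<le> 2 * DIM('a)\<close> leaves room for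
  \<open>n - DIM('a)\<close> groups of at least two points. Maximisers therefore have
  \<open>delta\<close> at least 1, which forces nonpositive inner products.\<close>

lemma is_SMC_iff:
  fixes W :: "nat \<Rightarrow> 'a::euclidean_space"
  assumes "DIM('a) + 2 \<le> n" "n \<le> 2 * DIM('a)"
  shows "is_SMC n W \<longleftrightarrow> on_sphere n W \<and> (\<forall>i<n. \<forall>j<n. i \<noteq> j \<longrightarrow> W i \<bullet> W j \<le> 0)"
proof
  assume smc: "is_SMC n W"
  obtain g where g: "partitions n (n - DIM('a)) g"
  proof -
    have "0 < n - DIM('a)" "2 * (n - DIM('a)) \<le> n" using assms by linarith+
    from ex_partitions[OF this] show thesis using that by blast
  qed
  obtain V :: "nat \<Rightarrow> 'a" where V: "\<forall>i<n. \<forall>j<n. V i \<bullet> V j = simplex_gram n g i j"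
    using ex_simplex_gram[OF g, where 'a = 'a] assms by auto
  have "1 \<le> delta n V"
    by (rule delta_ge_1_if_inner_nonpos) (use assms nonpos_if_simplex_gram[OF g V] in auto)
  also have "\<dots> \<le> delta n W"
    using smc nonpos_if_simplex_gram(1)[OF g V] by (simp add: is_SMC_def)
  finally have "1 \<le> delta n W" .
  moreover have "on_sphere n W" using smc by (simp add: is_SMC_def)
  ultimately show "on_sphere n W \<and> (\<forall>i<n. \<forall>j<n. i \<noteq> j \<longrightarrow> W i \<bullet> W j \<le> 0)"
    using inner_nonpos_if_delta_ge_1[OF assms(1)] by blast
next
  assume W: "on_sphere n W \<and> (\<forall>i<n. \<forall>j<n. i \<noteq> j \<longrightarrow> W i \<bullet> W j \<le> 0)"
  then have "1 \<le> delta n W" using assms by (intro delta_ge_1_if_inner_nonpos) auto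
  then show "is_SMC n W"
    using W delta_le_1[OF assms(1)] unfolding is_SMC_def by (meson order_trans)
qed

lemma SMC_orthogonal_partition:
  fixes W :: "nat \<Rightarrow> 'a::euclidean_space"
  assumes "DIM('a) + 2 \<le> n" "n \<le> 2 * DIM('a)" "is_SMC n W"
  shows "\<exists>g. partitions n (n - DIM('a)) g \<and> (\<forall>i<n. \<forall>j<n. g i \<noteq> g j \<longrightarrow> W i \<bullet> W j = 0)"
proof -
  obtain l where l: "n - DIM('a) = Suc l" using assms(1) by (cases "n - DIM('a)") auto
  have W: "on_sphere n W" "\<forall>i<n. \<forall>j<n. i \<noteq> j \<longrightarrow> W i \<bullet> W j \<le> 0"
    using is_SMC_iff[OF assms(1,2)] assms(3) by blast+
  have dim: "dim (W ` {..<n}) + Suc l \<le> card {..<n}"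
    using dim_subset_UNIV[of "W ` {..<n}"] l assms(1) by simp
  have "\<exists>g. g ` {..<n} \<subseteq> {..l} \<and> (\<forall>c\<le>l. 2 \<le> card {i \<in> {..<n}. g i = c}) \<and>
      (\<forall>i\<in>{..<n}. \<forall>j\<in>{..<n}. g i \<noteq> g j \<longrightarrow> W i \<bullet> W j = 0)"
    by (rule orthogonal_partition[OF _ _ _ dim]) (use W in \<open>auto simp: on_sphere_def\<close>)
  then show ?thesis
    unfolding l partitions_def fiber_def by (elim exE, rule_tac x = g in exI) (auto simp: less_Suc_eq_le)
qed

text \<open>The tangent bound puts \<open>lse\<close> of some \<open>simplex_gram n g\<close> below
  that of \<open>W\<close>, and minimality puts \<open>lse\<close> of \<open>W\<close> below that of
  every realised \<open>simplex_gram n h\<close>. Taking \<open>h = g\<close> yields equality, hence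
  the Gram matrix.\<close>

lemma CE_minimizer_on_SMC_simplex_gram:
  fixes W :: "nat \<Rightarrow> 'a::euclidean_space"
  assumes n: "DIM('a) + 2 \<le> n" "n \<le> 2 * DIM('a)"
    and "0 < \<tau>" and W: "CE_minimizer_on_SMC \<tau> n W"
  obtains g where "partitions n (n - DIM('a)) g"
    "\<forall>i<n. \<forall>j<n. W i \<bullet> W j = simplex_gram n g i j"
    "\<forall>h. partitions n (n - DIM('a)) h \<longrightarrow>
      lse n (1 / \<tau>) (simplex_gram n g) \<le> lse n (1 / \<tau>) (simplex_gram n h)"
proof -
  let ?k = "n - DIM('a)"
  let ?M = "\<lambda>i j. W i \<bullet> W j"
  have smc: "is_SMC n W" using W by (simp add: CE_minimizer_on_SMC_def)
  have sph: "on_sphere n W" using smc by (simp add: is_SMC_def)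
  have n0: "0 < n" using n by simp
  obtain g where g: "partitions n ?k g"
    and orth: "\<forall>i<n. \<forall>j<n. g i \<noteq> g j \<longrightarrow> W i \<bullet> W j = 0"
    using SMC_orthogonal_partition[OF n smc] by (elim exE conjE) (rule that)
  have ge: "lse n (1 / \<tau>) (simplex_gram n g) \<le> lse n (1 / \<tau>) ?M"
    and eq: "lse n (1 / \<tau>) ?M = lse n (1 / \<tau>) (simplex_gram n g) \<Longrightarrow>
      \<forall>i<n. \<forall>j<n. W i \<bullet> W j = simplex_gram n g i j"
  proof -
    have "0 < 1 / \<tau>" using \<open>0 < \<tau>\<close> by simp
    note lower = lse_ge_simplex_gram[OF g this, of W]
    have unit: "norm (W i) = 1" if "i < n" for i using sph that by (simp add: on_sphere_def)
    show "lse n (1 / \<tau>) (simplex_gram n g) \<le> lse n (1 / \<tau>) ?M"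
      by (rule lower(1)[OF unit]) (use orth in simp_all)
    show "\<forall>i<n. \<forall>j<n. W i \<bullet> W j = simplex_gram n g i j"
      if "lse n (1 / \<tau>) ?M = lse n (1 / \<tau>) (simplex_gram n g)"
      by (rule lower(2)[OF unit _ that]) (use orth in simp_all)
  qed
  have le: "lse n (1 / \<tau>) ?M \<le> lse n (1 / \<tau>) (simplex_gram n h)" if h: "partitions n ?k h" for h
  proof -
    obtain V :: "nat \<Rightarrow> 'a" where V: "\<forall>i<n. \<forall>j<n. V i \<bullet> V j = simplex_gram n h i j"
      using ex_simplex_gram[OF h, where 'a = 'a] n by auto
    note V' = nonpos_if_simplex_gram[OF h V]
    have "is_SMC n V" using V' by (simp add: is_SMC_iff[OF n])
    then have "CE_loss \<tau> n W \<le> CE_loss \<tau> n V" using W by (simp add: CE_minimizer_on_SMC_def)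
    then have "lse n (1 / \<tau>) ?M \<le> lse n (1 / \<tau>) (\<lambda>i j. V i \<bullet> V j)"
      using n0 by (simp add: CE_loss_eq_lse[OF sph n0] CE_loss_eq_lse[OF V'(1) n0] divide_le_cancel)
    also have "lse n (1 / \<tau>) (\<lambda>i j. V i \<bullet> V j) = lse n (1 / \<tau>) (simplex_gram n h)"
      using V by (simp add: lse_def)
    finally show ?thesis .
  qed
  show thesis
  proof (rule that[OF g])
    show "\<forall>i<n. \<forall>j<n. W i \<bullet> W j = simplex_gram n g i j" using eq ge le[OF g] by simp
    show "\<forall>h. partitions n ?k h \<longrightarrow>
        lse n (1 / \<tau>) (simplex_gram n g) \<le> lse n (1 / \<tau>) (simplex_gram n h)"
      using ge le by (meson order_trans)
  qed
qed

section \<open>Moving one point between groups\<close>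

text \<open>When a point moves from group \<open>b\<close> to group \<open>a\<close>, the summands
  of \<open>lse\<close> for all other groups stay the same. Three points in \<open>b\<close> ensure
  that two remain.\<close>

lemma move_between_fibers:
  assumes g: "partitions n k g" and ab: "a < k" "b < k" "a \<noteq> b" and card_b: "3 \<le> card (fiber n g b)"
  defines "\<phi> \<equiv> \<lambda>s m. real m * fiber_log n s m"
  obtains h where "partitions n k h"
    "\<And>s. lse n s (simplex_gram n h) + \<phi> s (card (fiber n g a)) + \<phi> s (card (fiber n g b))
      = lse n s (simplex_gram n g) + \<phi> s (Suc (card (fiber n g a))) + \<phi> s (card (fiber n g b) - 1)"
proof -
  have "fiber n g b \<noteq> {}" using card_b by auto
  then obtain i where i: "i \<in> fiber n g b" by blast
  define h where "h = g(i := a)"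
  have "fiber n h a = insert i (fiber n g a)" "fiber n h b = fiber n g b - {i}"
    using i ab by (auto simp: h_def fiber_def)
  moreover have "i \<notin> fiber n g a" using i ab by (auto simp: fiber_def)
  ultimately have ca: "card (fiber n h a) = Suc (card (fiber n g a))"
    and cb: "card (fiber n h b) = card (fiber n g b) - 1"
    using i by simp_all
  have other: "fiber n h c = fiber n g c" if "c \<noteq> a" "c \<noteq> b" for c
    using that i by (auto simp: h_def fiber_def)
  have h: "partitions n k h"
    unfolding partitions_def
  proof (intro conjI allI impI)
    show "h j < k" if "j < n" for j using that g ab by (auto simp: h_def partitions_def)
    show "2 \<le> card (fiber n h c)" if "c < k" for c
      using that g ca cb card_b other[of c] by (cases "c = a"; cases "c = b") (auto simp: partitions_def le_SucI)
  qed
  have split: "(\<Sum>c<k. f c) = f a + f b + (\<Sum>c\<in>{..<k} - {a, b}. f c)" for f :: "nat \<Rightarrow> real"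
  proof -
    have "(\<Sum>c<k. f c) = (\<Sum>c\<in>{..<k} - {a, b}. f c) + (\<Sum>c\<in>{a, b}. f c)"
      using ab by (intro sum.subset_diff) auto
    then show ?thesis using ab by simp
  qed
  have "(\<Sum>c\<in>{..<k} - {a, b}. \<phi> s (card (fiber n h c))) = (\<Sum>c\<in>{..<k} - {a, b}. \<phi> s (card (fiber n g c)))" for s
    using other by (intro sum.cong) auto
  moreover have "lse n s (simplex_gram n f) = (\<Sum>c<k. \<phi> s (card (fiber n f c)))" if "partitions n k f" for f s
    using lse_simplex_gram[OF that] by (simp add: \<phi>_def)
  ultimately show thesis
    by (intro that[OF h]) (simp add: g h split ca cb)
qed

section \<open>Geometry of configurations with a simplex Gram matrix\<close>

context
  fixes W :: "nat \<Rightarrow> 'a::euclidean_space" and n k :: nat and g :: "nat \<Rightarrow> nat"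
  assumes g: "partitions n k g"
    and gram: "\<forall>i<n. \<forall>j<n. W i \<bullet> W j = simplex_gram n g i j"
begin

lemma inj_on_if_simplex_gram: "inj_on W {..<n}"
proof (rule inj_onI, rule ccontr)
  fix i j assume ij: "i \<in> {..<n}" "j \<in> {..<n}" "W i = W j" "i \<noteq> j"
  have "W i \<bullet> W i = 1" using ij gram by (simp add: simplex_gram_def)
  moreover have "W i \<bullet> W j \<le> 0"
    using gram[rule_format, of i j] simplex_gram_nonpos[OF g, of i j] ij(1,2,4) by simp
  ultimately show False using ij(3) by simp
qed

text \<open>Each vector of the group is orthogonal to the sum, because
  \<open>1 + m * (- 1 / m) = 0\<close> with \<open>m\<close> the size minus 1; so the sum is
  orthogonal to itself.\<close>

lemma fiber_sum_eq_0:
  assumes "c < k"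
  shows "(\<Sum>i\<in>fiber n g c. W i) = 0"
proof -
  let ?F = "fiber n g c"
  define m where "m = real (card ?F) - 1"
  have m: "1 \<le> m" using g assms by (fastforce simp: partitions_def m_def)
  have "W i \<bullet> (\<Sum>j\<in>?F. W j) = 0" if i: "i \<in> ?F" for i
  proof -
    have "W i \<bullet> (\<Sum>j\<in>?F. W j) = W i \<bullet> W i + (\<Sum>j\<in>?F - {i}. W i \<bullet> W j)"
      unfolding inner_sum_right using i by (intro sum.remove) auto
    also have "W i \<bullet> W i = 1" using i gram by (auto simp: fiber_def simplex_gram_def)
    also have "(\<Sum>j\<in>?F - {i}. W i \<bullet> W j) = (\<Sum>j\<in>?F - {i}. - 1 / m)"
      using i gram by (intro sum.cong) (auto simp: fiber_def simplex_gram_def m_def)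
    also have "\<dots> = - 1" using i m by (simp add: m_def of_nat_diff)
    finally show ?thesis by simp
  qed
  then have "(\<Sum>i\<in>?F. W i) \<bullet> (\<Sum>j\<in>?F. W j) = 0" by (simp add: inner_sum_left)
  then show ?thesis by simp
qed

lemma reg_simplex_fiber:
  assumes "c < k"
  shows "reg_simplex (card (fiber n g c)) (W ` fiber n g c)"
proof -
  let ?F = "fiber n g c"
  have inj: "inj_on W ?F" using inj_on_if_simplex_gram by (rule inj_on_subset) (auto simp: fiber_def)
  have "dist (W i) (W j) = sqrt (2 + 2 / (real (card ?F) - 1))" if "i \<in> ?F" "j \<in> ?F" "i \<noteq> j" for i j
  proof -
    have "W i \<bullet> W j = - 1 / (real (card ?F) - 1)" "W i \<bullet> W i = 1" "W j \<bullet> W j = 1"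
      using that gram by (auto simp: fiber_def simplex_gram_def)
    then show ?thesis
      by (simp add: dist_norm norm_eq_sqrt_inner inner_diff inner_commute[of "W j" "W i"])
  qed
  then have "\<exists>c. \<forall>x\<in>W ` ?F. \<forall>y\<in>W ` ?F. x \<noteq> y \<longrightarrow> dist x y = c"
    by (intro exI[of _ "sqrt (2 + 2 / (real (card ?F) - 1))"]) auto
  moreover have "norm (W i) = 1" if "i \<in> ?F" for i
    using that gram by (simp add: norm_eq_1 fiber_def simplex_gram_def)
  ultimately show ?thesis
    using fiber_sum_eq_0[OF assms] by (simp add: reg_simplex_def card_image inj sum.reindex)
qed

lemma inner_fibers_eq_0:
  assumes "i \<in> fiber n g c" "j \<in> fiber n g c'" "c \<noteq> c'"
  shows "W i \<bullet> W j = 0"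
  using assms gram by (auto simp: fiber_def simplex_gram_def)

text \<open>Leaving out one vector from each group leaves linearly independent vectors: the coefficients
  of a linear relation are constant on every group, hence zero.\<close>

lemma span_if_simplex_gram:
  assumes "n = k + DIM('a)"
  shows "span (W ` {..<n}) = UNIV"
proof -
  obtain r where r: "\<forall>c<k. r c \<in> fiber n g c" and card_N: "card ({..<n} - r ` {..<k}) = n - k"
    using obtain_fiber_representatives[OF g] .
  define N where "N = {..<n} - r ` {..<k}"
  have "card N \<le> dim (W ` N)"
  proof (rule ccontr)
    assume "\<not> card N \<le> dim (W ` N)"
    then obtain u where u: "\<exists>i\<in>N. u i \<noteq> 0" "(\<Sum>i\<in>N. u i *\<^sub>R W i) = 0"
      using nontrivial_relation_if_dim_less_card[of N W] by (auto simp: N_def)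
    define v where "v i = (if i \<in> N then u i else 0)" for i
    have v0: "(\<Sum>i<n. v i *\<^sub>R W i) = 0"
    proof -
      have "(\<Sum>i<n. v i *\<^sub>R W i) = (\<Sum>i\<in>N. v i *\<^sub>R W i)"
        by (rule sum.mono_neutral_right) (auto simp: v_def N_def)
      then show ?thesis using u(2) by (simp add: v_def)
    qed
    have const: "v j * real (card (fiber n g c)) = (\<Sum>i\<in>fiber n g c. v i)"
      if c: "c < k" and j: "j \<in> fiber n g c" for c j
    proof -
      let ?F = "fiber n g c"
      define m where "m = real (card ?F) - 1"
      have m: "1 \<le> m" using g c by (fastforce simp: partitions_def m_def)
      have "0 = (\<Sum>i<n. v i *\<^sub>R W i) \<bullet> W j" using v0 by simp
      also have "\<dots> = (\<Sum>i<n. v i * (W i \<bullet> W j))" by (simp add: inner_sum_left)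
      also have "\<dots> = (\<Sum>i\<in>?F. v i * (W i \<bullet> W j))"
      proof (rule sum.mono_neutral_right)
        show "\<forall>i\<in>{..<n} - ?F. v i * (W i \<bullet> W j) = 0"
          using inner_fibers_eq_0[of _ _ j c] j by (auto simp: fiber_def)
      qed (auto simp: fiber_def)
      also have "\<dots> = v j * (W j \<bullet> W j) + (\<Sum>i\<in>?F - {j}. v i * (W i \<bullet> W j))"
        using j by (simp add: sum.remove[of ?F j])
      also have "W j \<bullet> W j = 1" using j gram by (auto simp: fiber_def simplex_gram_def)
      also have "(\<Sum>i\<in>?F - {j}. v i * (W i \<bullet> W j)) = (\<Sum>i\<in>?F - {j}. v i * (- 1 / m))"
        using j gram by (intro sum.cong) (auto simp: fiber_def simplex_gram_def m_def)
      also have "\<dots> = (\<Sum>i\<in>?F - {j}. v i) * (- 1 / m)" by (simp only: sum_distrib_right)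
      also have "(\<Sum>i\<in>?F - {j}. v i) = sum v ?F - v j" using j by (simp add: sum.remove[of ?F j])
      \<comment> \<open>Pairing with \<open>W j\<close> gave
        \<open>v j - (sum v ?F - v j) / m = 0\<close>; here \<open>m + 1\<close> is the group
        size.\<close>
      finally have "v j * (m + 1) = sum v ?F" using m by (simp add: field_simps)
      then show ?thesis by (simp add: m_def)
    qed
    have "v j = 0" if "j \<in> N" for j
    proof -
      have c: "g j < k" and jF: "j \<in> fiber n g (g j)"
        using that g by (auto simp: N_def partitions_def fiber_def)
      \<comment> \<open>The omitted representative has coefficient 0, which fixes the
        constant.\<close>
      have "v (r (g j)) = 0" using c by (simp add: v_def N_def)
      then have "(\<Sum>i\<in>fiber n g (g j). v i) = 0" using const[OF c, of "r (g j)"] r c by simp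
      then have "v j * real (card (fiber n g (g j))) = 0" using const[OF c jF] by simp
      moreover have "fiber n g (g j) \<noteq> {}" using jF by blast
      ultimately show ?thesis by simp
    qed
    then show False using u(1) by (auto simp: v_def)
  qed
  also have "\<dots> \<le> dim (W ` {..<n})" by (intro dim_subset) (auto simp: N_def)
  finally have "DIM('a) \<le> dim (W ` {..<n})" using card_N assms by (simp add: N_def)
  then show ?thesis using dim_subset_UNIV[of "W ` {..<n}"] by (simp add: dim_eq_full[symmetric])
qed

lemma image_fibers: "W ` {..<n} = (\<Union>c<k. W ` fiber n g c)"
  using g by (auto simp: fiber_def partitions_def)

text \<open>A group of two is an antipodal pair because its sum vanishes. One member of each pair
  other than group \<open>c0\<close> supplies the orthonormal set of the orthoplex; group
  \<open>c0\<close>, whatever its size, is the simplex.\<close>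

lemma low_entropy_if_card_fiber_eq_2:
  assumes "n = k + DIM('a)" and c0: "c0 < k"
    and card2: "\<And>c. c < k \<Longrightarrow> c \<noteq> c0 \<Longrightarrow> card (fiber n g c) = 2"
  shows "low_entropy (card (fiber n g c0)) n W"
proof -
  obtain r where r: "\<forall>c<k. r c \<in> fiber n g c"
    using obtain_fiber_representatives[OF g] .
  define C where "C = {..<k} - {c0}"
  define U where "U = (\<lambda>c. W (r c)) ` C"
  define Q where "Q = (\<Union>c\<in>C. W ` fiber n g c)"
  have img: "W ` fiber n g c = {W (r c), - W (r c)}" if c: "c \<in> C" for c
  proof -
    have c': "c < k" "c \<noteq> c0" using c by (auto simp: C_def)
    obtain x y where xy: "fiber n g c = {x, y}" "x \<noteq> y"
      using card2[OF c'] by (auto simp: card_2_iff)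
    have "W x + W y = 0" using fiber_sum_eq_0[OF c'(1)] xy by simp
    then have "W y = - W x" by (simp add: eq_neg_iff_add_eq_0 add.commute)
    moreover have "r c = x \<or> r c = y" using r c'(1) xy by auto
    ultimately show ?thesis using xy by auto
  qed
  have "pairwise orthogonal U"
  proof (rule pairwiseI)
    fix x y assume "x \<in> U" "y \<in> U" "x \<noteq> y"
    then obtain c c' where "x = W (r c)" "y = W (r c')" "c \<in> C" "c' \<in> C" "c \<noteq> c'"
      by (auto simp: U_def)
    then show "orthogonal x y"
      using inner_fibers_eq_0[of "r c" c "r c'" c'] r by (auto simp: orthogonal_def C_def)
  qed
  moreover have "norm (W (r c)) = 1" if "c \<in> C" for c
    using r that gram by (auto simp: C_def norm_eq_1 fiber_def simplex_gram_def)
  moreover have "Q = U \<union> uminus ` U" using img by (auto simp: Q_def U_def)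
  ultimately have "orthoplex Q"
    unfolding orthoplex_def by (intro exI[of _ U]) (auto simp: U_def C_def)
  moreover have cover: "W ` {..<n} = W ` fiber n g c0 \<union> Q"
    using c0 unfolding image_fibers Q_def C_def by auto
  moreover have "orthogonal x y" if "x \<in> span (W ` fiber n g c0)" "y \<in> span Q" for x y
    unfolding orthogonal_def
  proof (rule inner_span_eq_0[OF _ that])
    show "x \<bullet> y = 0" if "x \<in> W ` fiber n g c0" "y \<in> Q" for x y
      using that inner_fibers_eq_0[of _ c0] by (auto simp: Q_def C_def)
  qed
  ultimately show ?thesis
    unfolding low_entropy_def
    using inj_on_if_simplex_gram reg_simplex_fiber[OF c0] span_if_simplex_gram[OF assms(1)] by metis
qed

lemma high_entropy_if_card_fiber:
  assumes "n = k + DIM('a)"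
    and card: "\<And>c. c < k \<Longrightarrow> card (fiber n g c) = p \<or> card (fiber n g c) = Suc p"
  shows "high_entropy p n W"
proof -
  define F where "F = (\<lambda>c. W ` fiber n g c) ` {..<k}"
  have "finite F" by (simp add: F_def)
  moreover have "reg_simplex p S \<or> reg_simplex (Suc p) S" if "S \<in> F" for S
    using that reg_simplex_fiber card by (fastforce simp: F_def)
  moreover have "orthogonal x y"
    if AB: "A \<in> F" "B \<in> F" "A \<noteq> B" and xy: "x \<in> span A" "y \<in> span B" for A B x y
    unfolding orthogonal_def
  proof (rule inner_span_eq_0[OF _ xy])
    obtain c c' where "A = W ` fiber n g c" "B = W ` fiber n g c'" "c \<noteq> c'"
      using AB by (auto simp: F_def)
    then show "x \<bullet> y = 0" if "x \<in> A" "y \<in> B" for x y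
      using that inner_fibers_eq_0[of _ c _ c'] by auto
  qed
  moreover have "W ` {..<n} = \<Union>F" unfolding image_fibers F_def ..
  ultimately show ?thesis
    unfolding high_entropy_def
    using inj_on_if_simplex_gram span_if_simplex_gram[OF assms(1)] by metis
qed

end

section \<open>Uniform thresholds and the two temperature regimes\<close>

lemma ex_unbalancing_threshold:
  "\<exists>S>0. \<forall>s>S. \<forall>a\<le>n. \<forall>b\<le>a. 3 \<le> b \<longrightarrow>
     real (Suc a) * fiber_log n s (Suc a) + real (b - 1) * fiber_log n s (b - 1)
     < real a * fiber_log n s a + real b * fiber_log n s b"
proof -
  have "eventually (\<lambda>s. \<forall>a\<in>{..n}. \<forall>b\<in>{3..a}.
     real (Suc a) * fiber_log n s (Suc a) + real (b - 1) * fiber_log n s (b - 1)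
     < real a * fiber_log n s a + real b * fiber_log n s b) at_top"
    by (intro eventually_ball_finite ballI eventually_less_at_top_if_card_le) auto
  then obtain S where "\<forall>s\<ge>S. \<forall>a\<in>{..n}. \<forall>b\<in>{3..a}.
     real (Suc a) * fiber_log n s (Suc a) + real (b - 1) * fiber_log n s (b - 1)
     < real a * fiber_log n s a + real b * fiber_log n s b"
    by (auto simp: eventually_at_top_linorder)
  \<comment> \<open>The maximum makes the bound positive, so that its reciprocal can serve as a
    temperature.\<close>
  then show ?thesis by (intro exI[of _ "max S 1"]) auto
qed

lemma ex_balancing_threshold:
  assumes "0 < n"
  shows "\<exists>e>0. \<forall>s. 0 < s \<and> s < e \<longrightarrow> (\<forall>a\<le>n. \<forall>b. 2 \<le> b \<and> b + 2 \<le> a \<longrightarrow>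
     real (Suc b) * fiber_log n s (Suc b) + real (a - 1) * fiber_log n s (a - 1)
     < real a * fiber_log n s a + real b * fiber_log n s b)"
proof -
  have "eventually (\<lambda>s. \<forall>a\<in>{..n}. \<forall>b\<in>{b. 2 \<le> b \<and> b + 2 \<le> a}.
     real (Suc b) * fiber_log n s (Suc b) + real (a - 1) * fiber_log n s (a - 1)
     < real a * fiber_log n s a + real b * fiber_log n s b) (at_right 0)"
  proof (intro eventually_ball_finite ballI)
    show "finite {b. 2 \<le> b \<and> b + 2 \<le> a}" for a :: nat
      by (rule finite_subset[of _ "{..a}"]) auto
    fix a b :: nat assume "b \<in> {b. 2 \<le> b \<and> b + 2 \<le> a}"
    then show "eventually (\<lambda>s. real (Suc b) * fiber_log n s (Suc b) + real (a - 1) * fiber_log n s (a - 1)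
        < real a * fiber_log n s a + real b * fiber_log n s b) (at_right 0)"
      by (intro eventually_less_at_right_0_if_card_diff_ge_2[OF _ _ assms]) auto
  qed simp
  then obtain e where "0 < e" "\<forall>s>0. s < e \<longrightarrow> (\<forall>a\<in>{..n}. \<forall>b\<in>{b. 2 \<le> b \<and> b + 2 \<le> a}.
     real (Suc b) * fiber_log n s (Suc b) + real (a - 1) * fiber_log n s (a - 1)
     < real a * fiber_log n s a + real b * fiber_log n s b)"
    unfolding eventually_at_right_field by blast
  then show ?thesis by (intro exI[of _ e]) auto
qed

lemma card_fiber_le: "card (fiber n g c) \<le> n"
  using card_mono[of "{..<n}" "fiber n g c"] by (auto simp: fiber_def)

theorem theorem12:
  fixes n :: nat
  assumes "DIM('a::euclidean_space) + 2 \<le> n" and "n \<le> 2 * DIM('a)"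
  shows "\<exists>\<tau>m \<tau>p. 0 < \<tau>m \<and> \<tau>m < \<tau>p \<and>
     (\<forall>\<tau>. 0 < \<tau> \<and> \<tau> < \<tau>m \<longrightarrow>
        (\<forall>W :: nat \<Rightarrow> 'a. CE_minimizer_on_SMC \<tau> n W \<longrightarrow> (\<exists>p. low_entropy p n W))) \<and>
     (\<forall>\<tau>. \<tau>p < \<tau> \<longrightarrow>
        (\<forall>W :: nat \<Rightarrow> 'a. CE_minimizer_on_SMC \<tau> n W \<longrightarrow> (\<exists>p. high_entropy p n W)))"
proof -
  let ?k = "n - DIM('a)"
  have k: "2 \<le> ?k" "n = ?k + DIM('a)" "0 < n" using assms by linarith+
  obtain S where S: "0 < S" "\<And>s a b. S < s \<Longrightarrow> a \<le> n \<Longrightarrow> b \<le> a \<Longrightarrow> 3 \<le> b \<Longrightarrow>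
     real (Suc a) * fiber_log n s (Suc a) + real (b - 1) * fiber_log n s (b - 1)
     < real a * fiber_log n s a + real b * fiber_log n s b"
    using ex_unbalancing_threshold[of n] by metis
  obtain e where e: "0 < e" "\<And>s a b. 0 < s \<Longrightarrow> s < e \<Longrightarrow> a \<le> n \<Longrightarrow> 2 \<le> b \<Longrightarrow> b + 2 \<le> a \<Longrightarrow>
     real (Suc b) * fiber_log n s (Suc b) + real (a - 1) * fiber_log n s (a - 1)
     < real a * fiber_log n s a + real b * fiber_log n s b"
    using ex_balancing_threshold[OF k(3)] by metis
  have low: "\<exists>p. low_entropy p n W"
    if \<tau>: "0 < \<tau>" "\<tau> < 1 / S" and W: "CE_minimizer_on_SMC \<tau> n W" for \<tau> and W :: "nat \<Rightarrow> 'a"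
  proof -
    obtain g where g: "partitions n ?k g" and gram: "\<forall>i<n. \<forall>j<n. W i \<bullet> W j = simplex_gram n g i j"
      and min: "\<forall>h. partitions n ?k h \<longrightarrow>
        lse n (1 / \<tau>) (simplex_gram n g) \<le> lse n (1 / \<tau>) (simplex_gram n h)"
      using CE_minimizer_on_SMC_simplex_gram[OF assms \<tau>(1) W] .
    have s: "S < 1 / \<tau>" using \<tau> S(1) by (simp add: field_simps)
    \<comment> \<open>Otherwise moving a point from \<open>b\<close> to the group \<open>a\<close>,
      which is at least as large, would lower \<open>lse\<close>, against minimality.\<close>
    have le2: "card (fiber n g b) < 3"
      if ab: "a < ?k" "b < ?k" "a \<noteq> b" "card (fiber n g b) \<le> card (fiber n g a)" for a b
    proof (rule ccontr)
      assume "\<not> card (fiber n g b) < 3"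
      then have b3: "3 \<le> card (fiber n g b)" by simp
      show False
      proof (rule move_between_fibers[OF g ab(1-3) b3])
        fix h
        assume "partitions n ?k h"
        then have "lse n (1 / \<tau>) (simplex_gram n g) \<le> lse n (1 / \<tau>) (simplex_gram n h)"
          using min by blast
        moreover assume "\<And>s. lse n s (simplex_gram n h) + real (card (fiber n g a)) * fiber_log n s (card (fiber n g a))
            + real (card (fiber n g b)) * fiber_log n s (card (fiber n g b))
          = lse n s (simplex_gram n g) + real (Suc (card (fiber n g a))) * fiber_log n s (Suc (card (fiber n g a)))
            + real (card (fiber n g b) - 1) * fiber_log n s (card (fiber n g b) - 1)"
        note this[of "1 / \<tau>"]
        ultimately show False
          using S(2)[OF s card_fiber_le ab(4) b3] by linarith
      qed
    qed
    \<comment> \<open>Two groups of at least three points would contradict \<open>le2\<close>,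
      applied with the smaller one as \<open>b\<close>. If there is no such group, any label can be
      \<open>c0\<close>.\<close>
    have "\<exists>c0<?k. \<forall>c<?k. c \<noteq> c0 \<longrightarrow> card (fiber n g c) < 3"
    proof (cases "\<exists>c<?k. 3 \<le> card (fiber n g c)")
      case True
      then obtain c0 where c0: "c0 < ?k" "3 \<le> card (fiber n g c0)" by blast
      have "card (fiber n g c) < 3" if "c < ?k" "c \<noteq> c0" for c
        using le2[of c0 c] le2[of c c0] that c0 by linarith
      then show ?thesis using c0 by blast
    next
      case False
      then show ?thesis using k(1) by (intro exI[of _ 0]) auto
    qed
    then obtain c0 where c0: "c0 < ?k" "\<And>c. c < ?k \<Longrightarrow> c \<noteq> c0 \<Longrightarrow> card (fiber n g c) < 3" by blast
    have "card (fiber n g c) = 2" if "c < ?k" "c \<noteq> c0" for c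
    proof -
      have "2 \<le> card (fiber n g c)" using g that(1) by (simp add: partitions_def)
      with c0(2)[OF that] show ?thesis by linarith
    qed
    then show ?thesis using low_entropy_if_card_fiber_eq_2[OF g gram k(2) c0(1)] by blast
  qed
  have high: "\<exists>p. high_entropy p n W"
    if \<tau>: "1 / e < \<tau>" and W: "CE_minimizer_on_SMC \<tau> n W" for \<tau> and W :: "nat \<Rightarrow> 'a"
  proof -
    have "0 < 1 / e" using e(1) by simp
    then have \<tau>0: "0 < \<tau>" using \<tau> by linarith
    obtain g where g: "partitions n ?k g" and gram: "\<forall>i<n. \<forall>j<n. W i \<bullet> W j = simplex_gram n g i j"
      and min: "\<forall>h. partitions n ?k h \<longrightarrow>
        lse n (1 / \<tau>) (simplex_gram n g) \<le> lse n (1 / \<tau>) (simplex_gram n h)"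
      using CE_minimizer_on_SMC_simplex_gram[OF assms \<tau>0 W] .
    have s: "0 < 1 / \<tau>" "1 / \<tau> < e" using \<tau> \<tau>0 e(1) by (simp_all add: field_simps)
    \<comment> \<open>A gap of two or more would let a point move from \<open>b\<close> to
      \<open>a\<close> and lower \<open>lse\<close>.\<close>
    have balanced: "card (fiber n g b) < card (fiber n g a) + 2"
      if ab: "a < ?k" "b < ?k" for a b
    proof (rule ccontr)
      assume "\<not> ?thesis"
      then have ge: "card (fiber n g a) + 2 \<le> card (fiber n g b)" by simp
      then have ne: "a \<noteq> b" by auto
      have a2: "2 \<le> card (fiber n g a)" using g ab(1) by (simp add: partitions_def)
      then have b3: "3 \<le> card (fiber n g b)" using ge by linarith
      show False
      proof (rule move_between_fibers[OF g ab ne b3])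
        fix h
        assume "partitions n ?k h"
        then have "lse n (1 / \<tau>) (simplex_gram n g) \<le> lse n (1 / \<tau>) (simplex_gram n h)"
          using min by blast
        moreover assume "\<And>s. lse n s (simplex_gram n h) + real (card (fiber n g a)) * fiber_log n s (card (fiber n g a))
            + real (card (fiber n g b)) * fiber_log n s (card (fiber n g b))
          = lse n s (simplex_gram n g) + real (Suc (card (fiber n g a))) * fiber_log n s (Suc (card (fiber n g a)))
            + real (card (fiber n g b) - 1) * fiber_log n s (card (fiber n g b) - 1)"
        note this[of "1 / \<tau>"]
        ultimately show False
          using e(2)[OF s card_fiber_le a2 ge] by linarith
      qed
    qed
    \<comment> \<open>With the smallest size as parameter, \<open>balanced\<close> confines all
      sizes to \<open>p\<close> and \<open>Suc p\<close>.\<close>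
    define p where "p = Min ((\<lambda>c. card (fiber n g c)) ` {..<?k})"
    have "p \<in> (\<lambda>c. card (fiber n g c)) ` {..<?k}"
      unfolding p_def using k(1) by (intro Min_in) (auto simp: lessThan_empty_iff)
    then obtain a where a: "a < ?k" "p = card (fiber n g a)" by auto
    have "card (fiber n g c) = p \<or> card (fiber n g c) = Suc p" if "c < ?k" for c
    proof -
      have "p \<le> card (fiber n g c)" unfolding p_def using that by (intro Min_le) auto
      then show ?thesis using balanced[OF a(1) that] a(2) by linarith
    qed
    then show ?thesis using high_entropy_if_card_fiber[OF g gram k(2)] by blast
  qed
  \<comment> \<open>The high-temperature argument needs only \<open>1 / e\<close>; the maximum with
    \<open>1 / S + 1\<close> puts the upper threshold above the lower one,
    \<open>1 / S\<close>.\<close>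
  have "0 < 1 / S" "1 / S < max (1 / e) (1 / S + 1)" using S(1) by auto
  moreover have "1 / e < \<tau>" if "max (1 / e) (1 / S + 1) < \<tau>" for \<tau> using that by simp
  ultimately show ?thesis
    using low high by (intro exI[of _ "1 / S"] exI[of _ "max (1 / e) (1 / S + 1)"]) blast
qed

end
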